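(* Let $\varrho$ and $\sigma$ be states (density matrices) on $\mathbb{C}^d$. The transition $\varrho\to\sigma$ by noisy operations is possible if and only if $\sigma$ is more mixed than $\varrho$, i.e. $\sigma\succ\varrho$.
   Context: A state on $\mathbb{C}^d$ is a positive semidefinite operator of trace $1$. The maximally mixed state on $\mathbb{C}^K$ is $\tau_K = \mathbb{1}/K$. Noisy operations (NO) are the maps on states obtained as finite compositions of the following: (1) unitary transformations $\varrho\mapsto U\varrho U^\dagger$; (2) adding an ancilla in a maximally mixed state, $\varrho\mapsto\varrho\otimes\tau_K$, for an arbitrary finite dimension $K$; (3) discarding a subsystem, i.e. taking the partial trace over a tensor factor of the Hilbert space (for any identification of the Hilbert space with a tensor product $\mathbb{C}^a\otimes\mathbb{C}^b$). The transition $\varrho\to\sigma$ by NO is called possible if it can be performed with arbitrarily high accuracy: for every $\epsilon>0$ there is a noisy operation $\Lambda$ from states on $\mathbb{C}^d$ to states on $\mathbb{C}^d$ with $\|\Lambda(\varrho)-\sigma\|\le\epsilon$ (trace norm). More mixed: for states $\varrho,\varrho'$ on $\mathbb{C}^d$ with eigenvalues in decreasing order $\lambda_1\ge\dots\ge\lambda_d$ and $\lambda'_1\ge\dots\ge\lambda'_d$, one says that $\varrho$ is more mixed than $\varrho'$, written $\varrho\succ\varrho'$, if $\sum_{i=1}^k\lambda_i\le\sum_{i=1}^k\lambda'_i$ for all $k\le d$. *)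

theory Defs
  imports
    "Jordan_Normal_Form.Char_Poly"
    "Jordan_Normal_Form.Schur_Decomposition"
    "HOL-Computational_Algebra.Fundamental_Theorem_Algebra"
begin

definition mtrace :: "complex mat \<Rightarrow> complex" where
  "mtrace A = (\<Sum>i<dim_row A. A $$ (i, i))"

(* The order on complex numbers is the componentwise one, so 0 \<le> z says that z is real and
   nonnegative; in particular a positive semidefinite matrix is Hermitian. *)
definition pos_semidef :: "nat \<Rightarrow> complex mat \<Rightarrow> bool" where
  "pos_semidef d A \<longleftrightarrow>
     A \<in> carrier_mat d d \<and> (\<forall>v \<in> carrier_vec d. 0 \<le> (A *\<^sub>v v) \<bullet>c v)"

definition state :: "nat \<Rightarrow> complex mat \<Rightarrow> bool" where
  "state d \<rho> \<longleftrightarrow> pos_semidef d \<rho> \<and> mtrace \<rho> = 1"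

definition max_mixed :: "nat \<Rightarrow> complex mat" where
  "max_mixed K = (1 / of_nat K) \<cdot>\<^sub>m 1\<^sub>m K"

definition unitary_mat :: "nat \<Rightarrow> complex mat \<Rightarrow> bool" where
  "unitary_mat n U \<longleftrightarrow>
     U \<in> carrier_mat n n \<and> U * mat_adjoint U = 1\<^sub>m n \<and> mat_adjoint U * U = 1\<^sub>m n"

(* The basis vector e_i \<otimes> e_k of C^a \<otimes> C^b has index i * b + k. *)
definition tensor_mat :: "complex mat \<Rightarrow> complex mat \<Rightarrow> complex mat" where
  "tensor_mat A B =
     mat (dim_row A * dim_row B) (dim_col A * dim_col B)
       (\<lambda>(i, j). A $$ (i div dim_row B, j div dim_col B) * B $$ (i mod dim_row B, j mod dim_col B))"

definition partial_trace :: "nat \<Rightarrow> nat \<Rightarrow> complex mat \<Rightarrow> complex mat" where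
  "partial_trace a b A = mat a a (\<lambda>(i, j). \<Sum>k<b. A $$ (i * b + k, j * b + k))"

lemma partial_trace_tensor_mat:
  assumes A: "A \<in> carrier_mat a a" and B: "B \<in> carrier_mat b b"
  shows "partial_trace a b (tensor_mat A B) = mtrace B \<cdot>\<^sub>m A"
proof (rule eq_matI)
  fix i j assume "i < dim_row (mtrace B \<cdot>\<^sub>m A)" "j < dim_col (mtrace B \<cdot>\<^sub>m A)"
  then have ij: "i < a" "j < a" using A by auto
  have lt: "m * b + k < a * b" if "m < a" "k < b" for m k
  proof -
    have "m * b + k < Suc m * b" using that by simp
    also have "\<dots> \<le> a * b" using that by (intro mult_right_mono) auto
    finally show ?thesis .
  qed
  have "tensor_mat A B $$ (i * b + k, j * b + k) = A $$ (i, j) * B $$ (k, k)" if "k < b" for k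
    using lt[OF ij(1) that] lt[OF ij(2) that] that A B by (auto simp: tensor_mat_def)
  then show "partial_trace a b (tensor_mat A B) $$ (i, j) = (mtrace B \<cdot>\<^sub>m A) $$ (i, j)"
    using ij A B by (simp add: partial_trace_def mtrace_def sum_distrib_left mult.commute)
qed (use A in \<open>auto simp: partial_trace_def\<close>)

(* noisy_op m n L: L is a noisy operation from states on C^m to states on C^n (its values on other
   matrices play no role). In discard, the unitary V is the identification of C^(a*b) with
   C^a \<otimes> C^b; as V is arbitrary, discarding the second factor covers discarding the first. *)
inductive noisy_op :: "nat \<Rightarrow> nat \<Rightarrow> (complex mat \<Rightarrow> complex mat) \<Rightarrow> bool" where
  unitary: "unitary_mat n U \<Longrightarrow> noisy_op n n (\<lambda>\<rho>. U * \<rho> * mat_adjoint U)"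
| ancilla: "K > 0 \<Longrightarrow> noisy_op n (n * K) (\<lambda>\<rho>. tensor_mat \<rho> (max_mixed K))"
| discard: "a > 0 \<Longrightarrow> b > 0 \<Longrightarrow> unitary_mat (a * b) V \<Longrightarrow>
     noisy_op (a * b) a (\<lambda>\<rho>. partial_trace a b (V * \<rho> * mat_adjoint V))"
| compose: "noisy_op l m \<Lambda> \<Longrightarrow> noisy_op m n \<Gamma> \<Longrightarrow> noisy_op l n (\<Gamma> \<circ> \<Lambda>)"

(* The sum of the singular values: the roots of the characteristic polynomial of A^* A, counted
   with multiplicity, are real and nonnegative, so Re loses nothing. *)
definition trace_norm :: "complex mat \<Rightarrow> real" where
  "trace_norm A = (\<Sum>x \<in># proots (char_poly (mat_adjoint A * A)). sqrt (Re x))"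

definition no_transition :: "nat \<Rightarrow> complex mat \<Rightarrow> complex mat \<Rightarrow> bool" where
  "no_transition d \<rho> \<sigma> \<longleftrightarrow>
     (\<forall>\<epsilon>>0. \<exists>\<Lambda>. noisy_op d d \<Lambda> \<and> trace_norm (\<Lambda> \<rho> - \<sigma>) \<le> \<epsilon>)"

(* Meant for Hermitian A, whose eigenvalues are real: they are listed with multiplicity, in
   decreasing order. *)
definition eigvals_decr :: "complex mat \<Rightarrow> real list" where
  "eigvals_decr A = rev (sorted_list_of_multiset (image_mset Re (proots (char_poly A))))"

(* more_mixed d \<rho> \<rho>' says that \<rho> is more mixed than \<rho>', i.e. that \<rho>' majorizes \<rho>. *)
definition more_mixed :: "nat \<Rightarrow> complex mat \<Rightarrow> complex mat \<Rightarrow> bool" where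
  "more_mixed d \<rho> \<rho>' \<longleftrightarrow>
     (\<forall>k\<le>d. (\<Sum>i<k. eigvals_decr \<rho> ! i) \<le> (\<Sum>i<k. eigvals_decr \<rho>' ! i))"

end

(* Every noisy operation is positive, trace preserving and unital up to normalization, and such a
   map from C^d to itself cannot increase the sum of the k largest eigenvalues; since diagonal
   entries in any orthonormal basis vary by at most the trace norm, this survives approximation.
   Conversely, if sigma is more mixed than rho, then finitely many T-transforms (Hardy, Littlewood,
   Polya) turn the spectrum of rho into that of sigma. A T-transform with rational weight m / K is a
   swap of two levels controlled by a maximally mixed ancilla of dimension K, and rational weights
   suffice because the composition depends continuously on the weights. *)

theory Submission
  imports Defs
begin

section \<open>Unitary diagonalization\<close>

text \<open>In the construction, accuracy is controlled on eigenvalue vectors rather than on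
  matrices: the target and its approximation are both diagonal in one eigenbasis of
  \<open>\<sigma>\<close>, so the trace norm of their difference is a sum of entrywise errors.
  Together with the other direction, the trace norm enters only through its invariance under unitary
  conjugation, its value on diagonal matrices and a bound on diagonal entries; no triangle
  inequality is involved. The spectral theorem is proved for a prescribed list of eigenvalues, so
  that the decreasing list behind \<open>more_mixed\<close> is itself the diagonal. A noisy
  operation passes through spaces of different dimensions, where the identity is preserved only up
  to the ratio of dimensions. The ratio becomes 1 because the composite starts and ends in dimension
  \<open>d\<close>. A swap controlled by a uniform ancilla yields rational weights only; allowing
  approximation in the notion of transition is what brings irrational weights within reach.\<close>

lemma dim_mat_adjoint [simp]:
  "dim_row (mat_adjoint A) = dim_col A" "dim_col (mat_adjoint A) = dim_row A"
  by (auto simp: mat_adjoint_def)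

lemma mat_adjoint_carrier:
  "A \<in> carrier_mat m n \<Longrightarrow> mat_adjoint A \<in> carrier_mat n m"
  by (intro carrier_matI) auto

lemma index_mat_adjoint [simp]:
  "i < dim_col A \<Longrightarrow> j < dim_row A \<Longrightarrow> mat_adjoint A $$ (i, j) = conjugate (A $$ (j, i))"
  by (auto simp: mat_adjoint_def mat_of_rows_def)

lemma mat_adjoint_adjoint [simp]: "mat_adjoint (mat_adjoint A) = A"
  by (rule eq_matI) auto

lemma index_mult_mat_sum:
  fixes A B :: "'a :: semiring_0 mat"
  assumes "A \<in> carrier_mat l m" "B \<in> carrier_mat m n" "i < l" "j < n"
  shows "(A * B) $$ (i, j) = (\<Sum>k<m. A $$ (i, k) * B $$ (k, j))"
  using assms by (auto simp: scalar_prod_def atLeast0LessThan intro!: sum.cong)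

lemma mat_adjoint_mult:
  fixes A B :: "complex mat"
  assumes "A \<in> carrier_mat l m" "B \<in> carrier_mat m n"
  shows "mat_adjoint (A * B) = mat_adjoint B * mat_adjoint A"
  by (rule eq_matI)
    (use assms in \<open>auto simp: scalar_prod_def mult.commute intro!: sum.cong\<close>)

section \<open>Algebra of unitary conjugation\<close>

lemma unitary_matD:
  assumes "unitary_mat n U"
  shows "U \<in> carrier_mat n n" "mat_adjoint U \<in> carrier_mat n n"
    "U * mat_adjoint U = 1\<^sub>m n" "mat_adjoint U * U = 1\<^sub>m n"
  using assms by (auto simp: unitary_mat_def)

lemma unitary_matI:
  fixes U :: "complex mat"
  assumes "U \<in> carrier_mat n n" "mat_adjoint U * U = 1\<^sub>m n"
  shows "unitary_mat n U"
  using assms mat_adjoint_carrier[OF assms(1)] mat_mult_left_right_inverse[of "mat_adjoint U" n U]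
  by (auto simp: unitary_mat_def)

lemma unitary_mat_adjoint: "unitary_mat n U \<Longrightarrow> unitary_mat n (mat_adjoint U)"
  by (auto simp: unitary_mat_def)

lemma unitary_mat_cancel:
  assumes "unitary_mat n U" "A \<in> carrier_mat n m"
  shows "U * (mat_adjoint U * A) = A" "mat_adjoint U * (U * A) = A"
proof -
  note U = unitary_matD[OF assms(1)]
  have "U * (mat_adjoint U * A) = (U * mat_adjoint U) * A"
    by (rule assoc_mult_mat[symmetric, OF U(1,2) assms(2)])
  then show "U * (mat_adjoint U * A) = A" using U(3) assms(2) by simp
  have "mat_adjoint U * (U * A) = (mat_adjoint U * U) * A"
    by (rule assoc_mult_mat[symmetric, OF U(2,1) assms(2)])
  then show "mat_adjoint U * (U * A) = A" using U(4) assms(2) by simp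
qed

lemma unitary_mat_mult:
  assumes U: "unitary_mat n U" and V: "unitary_mat n V"
  shows "unitary_mat n (U * V)"
proof (rule unitary_matI)
  note u = unitary_matD[OF U] and v = unitary_matD[OF V]
  show "U * V \<in> carrier_mat n n" using u v by auto
  have "mat_adjoint (U * V) * (U * V) = mat_adjoint V * (mat_adjoint U * (U * V))"
    using u v by (simp add: mat_adjoint_mult[OF u(1) v(1)] assoc_mult_mat[of _ n n _ n _ n])
  then show "mat_adjoint (U * V) * (U * V) = 1\<^sub>m n"
    using unitary_mat_cancel(2)[OF U v(1)] v(4) by simp
qed

lemma unitary_conj_cancel:
  assumes U: "unitary_mat n U" and A: "A \<in> carrier_mat n n"
  shows "U * (mat_adjoint U * A * U) * mat_adjoint U = A"
    and "mat_adjoint U * (U * A * mat_adjoint U) * U = A"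
proof -
  note u = unitary_matD[OF U]
  have "U * (mat_adjoint U * A * U) * mat_adjoint U
      = (U * (mat_adjoint U * A)) * (U * mat_adjoint U)"
    using A u(1,2) by (simp add: assoc_mult_mat[of _ n n _ n _ n])
  then show "U * (mat_adjoint U * A * U) * mat_adjoint U = A"
    using A by (simp add: unitary_mat_cancel[OF U A] u)
  have "mat_adjoint U * (U * A * mat_adjoint U) * U
      = (mat_adjoint U * (U * A)) * (mat_adjoint U * U)"
    using A u(1,2) by (simp add: assoc_mult_mat[of _ n n _ n _ n])
  then show "mat_adjoint U * (U * A * mat_adjoint U) * U = A"
    using A by (simp add: unitary_mat_cancel[OF U A] u)
qed

lemma char_poly_unitary_conj:
  assumes U: "unitary_mat n U" and A: "A \<in> carrier_mat n n"
  shows "char_poly (U * A * mat_adjoint U) = char_poly A"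
  using U A unitary_matD[OF U]
  by (intro char_poly_similar similar_matI[of _ _ U "mat_adjoint U" n]) auto

text \<open>Gram-Schmidt leaves the first vector of a basis completion of \<open>v\<close>
  unchanged, so normalizing its output only rescales \<open>v\<close>. The scalar \<open>c\<close>
  stays open because only the direction of the column matters for an eigenvector.\<close>

lemma unitary_with_first_column:
  fixes v :: "complex vec"
  assumes v: "v \<in> carrier_vec n" "v \<noteq> 0\<^sub>v n"
  obtains W c where "unitary_mat n W" "col W 0 = c \<cdot>\<^sub>v v"
proof -
  have n: "n > 0" using v by (cases n) auto
  interpret cof_vec_space n "TYPE(complex)" .
  define ws where "ws = gram_schmidt n (basis_completion v)"
  note b = basis_completion[OF v]
  note gs = gram_schmidt_result[OF b(2,4,5) ws_def]
  obtain vs where vs: "basis_completion v = v # vs"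
    using b(6,7) n by (cases "basis_completion v") auto
  have len: "length ws = n" using gs(4) b(6) by simp
  have hd: "ws ! 0 = v"
  proof -
    have "ws \<noteq> []" using len n by auto
    then show ?thesis
      using gram_schmidt_hd[OF v(1), of vs] hd_conv_nth[of ws] by (simp add: ws_def vs)
  qed
  have wc: "ws ! j \<in> carrier_vec n" if "j < n" for j
    using gs(3) len that by (metis nth_mem subsetD)
  \<comment> \<open>Gram-Schmidt delivers orthogonal vectors that are not normalized; these are
    their norms.\<close>
  define r where "r j = sqrt (Re (ws ! j \<bullet>c ws ! j))" for j
  define W where "W = mat n n (\<lambda>(i, j). ws ! j $ i / of_real (r j))"
  have sq: "of_real (r j) * of_real (r j) = ws ! j \<bullet>c ws ! j" "r j > 0" if "j < n" for j
  proof -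
    have "ws ! j \<bullet>c ws ! j \<noteq> 0"
      using corthogonalD[OF gs(2), of j j] len that by auto
    moreover have "ws ! j \<bullet>c ws ! j \<ge> 0" by (rule conjugate_square_ge_0_vec)
    ultimately show "of_real (r j) * of_real (r j) = ws ! j \<bullet>c ws ! j" "r j > 0"
      by (auto simp: r_def complex_eq_iff less_eq_complex_def simp flip: of_real_mult)
  qed
  have "mat_adjoint W * W = 1\<^sub>m n"
  proof (rule eq_matI)
    fix i j assume "i < dim_row (1\<^sub>m n :: complex mat)" "j < dim_col (1\<^sub>m n :: complex mat)"
    then have ij: "i < n" "j < n" by auto
    have "(mat_adjoint W * W) $$ (i, j)
        = (\<Sum>k<n. cnj (ws ! i $ k) * ws ! j $ k) / (of_real (r i) * of_real (r j))"
      using ij by (subst index_mult_mat_sum[of _ n n _ n])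
        (auto simp: W_def sum_divide_distrib intro!: sum.cong)
    also have "(\<Sum>k<n. cnj (ws ! i $ k) * ws ! j $ k) = ws ! j \<bullet>c ws ! i"
      using wc[OF ij(1)] wc[OF ij(2)]
      by (auto simp: scalar_prod_def atLeast0LessThan mult.commute intro!: sum.cong)
    also have "(ws ! j \<bullet>c ws ! i) / (of_real (r i) * of_real (r j)) = (if i = j then 1 else 0)"
      using corthogonalD[OF gs(2), of j i] sq[OF ij(1)] len ij
      by (cases "i = j") (auto simp flip: sq(1))
    finally show "(mat_adjoint W * W) $$ (i, j) = 1\<^sub>m n $$ (i, j)" using ij by simp
  qed (auto simp: W_def)
  then have "unitary_mat n W" by (intro unitary_matI) (auto simp: W_def)
  moreover have "col W 0 = (1 / of_real (r 0)) \<cdot>\<^sub>v v"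
    using n hd v by (intro eq_vecI) (auto simp: W_def)
  ultimately show thesis by (rule that)
qed

text \<open>Deflation along the list: conjugating by a unitary whose first column is an eigenvector
  splits off a block of size one, and the remaining block is again Hermitian with the remaining
  roots. Since the list comes from outside, its order can be chosen freely.\<close>

lemma hermitian_spectral:
  fixes A :: "complex mat"
  assumes "A \<in> carrier_mat n n" "mat_adjoint A = A" "char_poly A = (\<Prod>e\<leftarrow>es. [:- e, 1:])"
  shows "\<exists>U. unitary_mat n U \<and> A = U * mat_diag n (\<lambda>i. es ! i) * mat_adjoint U"
  using assms
proof (induction es arbitrary: n A)
  case Nil
  then have n: "n = 0" using degree_monic_char_poly[of A n] by auto
  have "unitary_mat n (1\<^sub>m n)" unfolding n by (rule unitary_matI) (auto intro!: eq_matI)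
  then show ?case using Nil n by (intro exI[of _ "1\<^sub>m n"]) (auto intro!: eq_matI)
next
  case (Cons e es n A)
  note A = Cons.prems(1)
  have cp: "char_poly A = [:- e, 1:] * (\<Prod>e\<leftarrow>es. [:- e, 1:])" using Cons.prems(3) by simp
  have "eigenvalue A e" unfolding eigenvalue_root_char_poly[OF A] cp by simp
  then obtain v where v: "v \<in> carrier_vec n" "v \<noteq> 0\<^sub>v n" "A *\<^sub>v v = e \<cdot>\<^sub>v v"
    using A by (auto simp: eigenvalue_def eigenvector_def)
  obtain W c where W: "unitary_mat n W" and col: "col W 0 = c \<cdot>\<^sub>v v"
    using unitary_with_first_column[OF v(1,2)] .
  note w = unitary_matD[OF W]
  obtain m where n: "n = Suc m" using v by (cases n) auto
  define A' where "A' = mat_adjoint W * A * W"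
  have A': "A' \<in> carrier_mat n n" using w A by (auto simp: A'_def)
  have herm: "mat_adjoint A' = A'"
    using w A Cons.prems(2)
    by (simp add: A'_def mat_adjoint_mult[of _ n n _ n] assoc_mult_mat[of _ n n _ n _ n])
  have col0: "A' $$ (i, 0) = (if i = 0 then e else 0)" if i: "i < n" for i
  proof -
    have "A *\<^sub>v col W 0 = e \<cdot>\<^sub>v col W 0"
      using v A by (simp add: col mult_mat_vec[of A n n] smult_smult_assoc mult.commute)
    then have "col (A * W) 0 = e \<cdot>\<^sub>v col W 0"
      using col_mult2[OF A w(1), of 0] n by (simp only: zero_less_Suc)
    moreover have "(mat_adjoint W * (A * W)) $$ (i, 0) = row (mat_adjoint W) i \<bullet> col (A * W) 0"
      by (rule index_mult_mat(1)) (use i n w(1) in auto)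
    ultimately have "(mat_adjoint W * (A * W)) $$ (i, 0)
        = row (mat_adjoint W) i \<bullet> (e \<cdot>\<^sub>v col W 0)" by metis
    also have "\<dots> = e * (mat_adjoint W * W) $$ (i, 0)"
      using i n w(1) by simp
    finally show ?thesis
      using i n w A unfolding A'_def by (simp add: assoc_mult_mat[of _ n n _ n _ n])
  qed
  \<comment> \<open>Hermiticity carries the zeros below the corner over to the first row, so
    \<open>A'\<close> is block diagonal.\<close>
  have row0: "A' $$ (0, i) = (if i = 0 then e else 0)" if i: "i < n" for i
  proof (cases "i = 0")
    case False
    have "A' $$ (0, i) = mat_adjoint A' $$ (0, i)" by (simp add: herm)
    also have "\<dots> = conjugate (A' $$ (i, 0))" using i A' n by (intro index_mat_adjoint) auto
    finally show ?thesis using False col0[OF i] by simp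
  qed (use col0 n in auto)
  define A3 where "A3 = mat m m (\<lambda>(i, j). A' $$ (Suc i, Suc j))"
  have A3: "A3 \<in> carrier_mat m m" by (simp add: A3_def)
  have blk: "A' = four_block_mat (mat 1 1 (\<lambda>_. e)) (0\<^sub>m 1 m) (0\<^sub>m m 1) A3"
    by (rule eq_matI) (use A' n row0 col0 in \<open>auto simp: A3_def\<close>)
  have herm3: "mat_adjoint A3 = A3"
  proof (rule eq_matI)
    fix i j assume "i < dim_row A3" "j < dim_col A3"
    then have ij: "i < m" "j < m" using A3 by auto
    have "A' $$ (Suc i, Suc j) = mat_adjoint A' $$ (Suc i, Suc j)" by (simp add: herm)
    also have "\<dots> = conjugate (A' $$ (Suc j, Suc i))"
      using ij A' n by (intro index_mat_adjoint) auto
    finally show "mat_adjoint A3 $$ (i, j) = A3 $$ (i, j)" using ij by (simp add: A3_def)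
  qed (auto simp: A3_def)
  have "char_poly A' = char_poly A"
    using char_poly_unitary_conj[OF unitary_mat_adjoint[OF W] A] by (simp add: A'_def)
  moreover have "char_poly A' = char_poly (mat 1 1 (\<lambda>_. e)) * char_poly A3"
    unfolding blk by (rule char_poly_four_block_zeros_col) (auto simp: A3_def)
  moreover have "char_poly (mat 1 1 (\<lambda>_. e)) = [:- e, 1:]"
    by (simp add: char_poly_defs det_def sign_def)
  \<comment> \<open>The corner contributes exactly the linear factor of \<open>e\<close>, which
    cancels because polynomials form an integral domain.\<close>
  ultimately have cp3: "char_poly A3 = (\<Prod>e\<leftarrow>es. [:- e, 1:])"
    using cp by (metis mult_cancel_left pCons_eq_0_iff zero_neq_one)
  obtain U3 where U3: "unitary_mat m U3" "A3 = U3 * mat_diag m (\<lambda>i. es ! i) * mat_adjoint U3"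
    using Cons.IH[OF A3 herm3 cp3] by auto
  note u3 = unitary_matD[OF U3(1)]
  define F where "F = four_block_mat (1\<^sub>m 1) (0\<^sub>m 1 m) (0\<^sub>m m 1) U3"
  have F: "F \<in> carrier_mat n n" using u3(1) n by (intro carrier_matI) (simp_all add: F_def)
  have Fa: "mat_adjoint F = four_block_mat (1\<^sub>m 1) (0\<^sub>m 1 m) (0\<^sub>m m 1) (mat_adjoint U3)"
    by (rule eq_matI) (use u3 in \<open>auto simp: F_def\<close>)
  have "mat_adjoint F * F = 1\<^sub>m n"
    unfolding Fa unfolding F_def n
    using u3 by (subst mult_four_block_mat[of _ 1 1 _ m _ m _ _ 1 _ m]) auto
  then have FU: "unitary_mat n F" using F by (intro unitary_matI)
  have D: "mat_diag n (\<lambda>i. (e # es) ! i)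
      = four_block_mat (mat 1 1 (\<lambda>_. e)) (0\<^sub>m 1 m) (0\<^sub>m m 1) (mat_diag m (\<lambda>i. es ! i))"
    by (rule eq_matI) (auto simp: mat_diag_def n nth_Cons')
  have dm: "mat_diag m ((!) es) \<in> carrier_mat m m" by simp
  have "F * mat_diag n (\<lambda>i. (e # es) ! i) * mat_adjoint F = A'"
    unfolding D Fa blk U3(2) unfolding F_def
    using u3 dm left_mult_zero_mat[OF dm, of 1] mult_carrier_mat[OF u3(1) dm]
    by (simp add: mult_four_block_mat[of _ 1 1 _ m _ m _ _ 1 _ m] del: mat_diag_dim)
  then have "A = W * (F * mat_diag n (\<lambda>i. (e # es) ! i) * mat_adjoint F) * mat_adjoint W"
    using unitary_conj_cancel(1)[OF W A] by (simp add: A'_def)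
  also have "\<dots> = (W * F) * mat_diag n (\<lambda>i. (e # es) ! i) * mat_adjoint (W * F)"
    using w F mat_adjoint_carrier[OF F] mat_diag_dim[of n "(!) (e # es)"]
    by (simp add: mat_adjoint_mult[OF w(1) F] assoc_mult_mat[of _ n n _ n _ n] del: mat_diag_dim)
  finally show ?case using unitary_mat_mult[OF W FU] by blast
qed

section \<open>Positive semidefinite matrices\<close>

lemma quadratic_form_sum:
  fixes A :: "complex mat"
  assumes "A \<in> carrier_mat n n"
  shows "(A *\<^sub>v vec n f) \<bullet>c vec n f = (\<Sum>i<n. \<Sum>j<n. A $$ (i, j) * f j * cnj (f i))"
  using assms by (auto simp: scalar_prod_def atLeast0LessThan sum_distrib_right intro!: sum.cong)

lemma pos_semidef_iff:
  "pos_semidef n A \<longleftrightarrow>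
    A \<in> carrier_mat n n \<and> (\<forall>f. 0 \<le> (\<Sum>i<n. \<Sum>j<n. A $$ (i, j) * f j * cnj (f i)))"
proof (intro iffI conjI allI)
  fix f assume A: "pos_semidef n A"
  then have "0 \<le> (A *\<^sub>v vec n f) \<bullet>c vec n f"
    by (auto simp: pos_semidef_def)
  also have "\<dots> = (\<Sum>i<n. \<Sum>j<n. A $$ (i, j) * f j * cnj (f i))"
    using A by (intro quadratic_form_sum) (simp add: pos_semidef_def)
  finally show "0 \<le> (\<Sum>i<n. \<Sum>j<n. A $$ (i, j) * f j * cnj (f i))" .
next
  assume A: "A \<in> carrier_mat n n \<and> (\<forall>f. 0 \<le> (\<Sum>i<n. \<Sum>j<n. A $$ (i, j) * f j * cnj (f i)))"
  show "pos_semidef n A" unfolding pos_semidef_def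
  proof (intro conjI ballI)
    fix v :: "complex vec" assume "v \<in> carrier_vec n"
    then have v: "v = vec n (\<lambda>i. v $ i)" by auto
    show "0 \<le> (A *\<^sub>v v) \<bullet>c v"
      using A quadratic_form_sum[of A n "\<lambda>i. v $ i"] unfolding v[symmetric] by simp
  qed (use A in simp)
qed (auto simp: pos_semidef_def)

lemma pos_semidef_carrier: "pos_semidef n A \<Longrightarrow> A \<in> carrier_mat n n"
  by (simp add: pos_semidef_def)

text \<open>The form is tested on the vector with coefficients \<open>a\<close> at \<open>i\<close>
  and \<open>b\<close> at \<open>j\<close>. The two contributions are added instead of chosen
  between, so \<open>i = j\<close> is covered as well.\<close>

lemma pos_semidef_two_entries:
  assumes A: "pos_semidef n A" and ij: "i < n" "j < n"
  shows "0 \<le> A $$ (i, i) * a * cnj a + A $$ (i, j) * b * cnj a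
    + A $$ (j, i) * a * cnj b + A $$ (j, j) * b * cnj b"
proof -
  define f where "f k = (if k = i then a else 0) + (if k = j then b else 0)" for k
  have "0 \<le> (\<Sum>k<n. \<Sum>l<n. A $$ (k, l) * f l * cnj (f k))"
    using A by (simp add: pos_semidef_iff)
  also have "(\<Sum>k<n. \<Sum>l<n. A $$ (k, l) * f l * cnj (f k))
      = (\<Sum>k<n. (A $$ (k, i) * a + A $$ (k, j) * b) * cnj (f k))"
    using ij by (simp add: f_def sum_distrib_right[symmetric] distrib_left sum.distrib
        if_distrib[of "\<lambda>x. _ * x"] cong: if_cong)
  also have "\<dots> = (A $$ (i, i) * a + A $$ (i, j) * b) * cnj a
      + (A $$ (j, i) * a + A $$ (j, j) * b) * cnj b"
    using ij by (simp add: f_def distrib_left sum.distrib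
        if_distrib[of "\<lambda>x. _ * x"] if_distrib[of cnj] cong: if_cong)
  finally show ?thesis by (simp add: algebra_simps)
qed

lemma pos_semidef_diag_nonneg:
  assumes "pos_semidef n A" "i < n"
  shows "0 \<le> A $$ (i, i)"
  using pos_semidef_two_entries[OF assms assms(2), of 1 0] by simp

lemma pos_semidef_hermitian:
  assumes A: "pos_semidef n A"
  shows "mat_adjoint A = A"
proof (rule eq_matI)
  note c = pos_semidef_carrier[OF A]
  fix i j assume "i < dim_row A" "j < dim_col A"
  then have ij: "i < n" "j < n" using c by auto
  note ge = pos_semidef_two_entries[OF A ij] pos_semidef_diag_nonneg[OF A ij(1)]
    pos_semidef_diag_nonneg[OF A ij(2)]
  \<comment> \<open>Polarization: the form is real at the coefficients 1, 1, which makes the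
    imaginary parts of the two entries opposite, and at 1 and the imaginary unit, which makes their
    real parts equal.\<close>
  have "cnj (A $$ (j, i)) = A $$ (i, j)"
    using ge(1)[of 1 1] ge(1)[of 1 \<i>] ge(2,3) by (auto simp: less_eq_complex_def complex_eq_iff)
  then show "mat_adjoint A $$ (i, j) = A $$ (i, j)" using ij c by simp
qed (use pos_semidef_carrier[OF A] in auto)

lemma mult_mat_vec_adjoint:
  fixes W :: "complex mat"
  assumes W: "W \<in> carrier_mat m n" and x: "x \<in> carrier_vec n" and v: "v \<in> carrier_vec m"
  shows "(W *\<^sub>v x) \<bullet>c v = x \<bullet>c (mat_adjoint W *\<^sub>v v)"
proof -
  have "(W *\<^sub>v x) \<bullet>c v = (\<Sum>i<m. \<Sum>j<n. W $$ (i, j) * x $ j * cnj (v $ i))"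
    using assms by (auto simp: scalar_prod_def atLeast0LessThan sum_distrib_right intro!: sum.cong)
  also have "\<dots> = (\<Sum>j<n. \<Sum>i<m. W $$ (i, j) * x $ j * cnj (v $ i))" by (rule sum.swap)
  also have "\<dots> = x \<bullet>c (mat_adjoint W *\<^sub>v v)"
    using assms by (auto simp: scalar_prod_def atLeast0LessThan sum_distrib_left mult_ac
        intro!: sum.cong)
  finally show ?thesis .
qed

lemma pos_semidef_conj:
  assumes A: "pos_semidef n A" and W: "W \<in> carrier_mat m n"
  shows "pos_semidef m (W * A * mat_adjoint W)"
  unfolding pos_semidef_def
proof (intro conjI ballI)
  note c = pos_semidef_carrier[OF A] and Wa = mat_adjoint_carrier[OF W]
  show "W * A * mat_adjoint W \<in> carrier_mat m m" using c W Wa by auto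
  fix v :: "complex vec" assume v: "v \<in> carrier_vec m"
  define w where "w = mat_adjoint W *\<^sub>v v"
  have w: "w \<in> carrier_vec n" using Wa v by (auto simp: w_def)
  have "W * A * mat_adjoint W *\<^sub>v v = W *\<^sub>v (A *\<^sub>v w)"
    using c W Wa v w by (simp add: w_def assoc_mult_mat_vec[of _ m n _ m]
        assoc_mult_mat_vec[of _ m n _ n] assoc_mult_mat_vec[of _ n n _ n])
  also have "\<dots> \<bullet>c v = (A *\<^sub>v w) \<bullet>c w"
    unfolding w_def by (rule mult_mat_vec_adjoint[OF W _ v]) (use c Wa v in auto)
  finally show "0 \<le> (W * A * mat_adjoint W *\<^sub>v v) \<bullet>c v"
    using A w by (simp add: pos_semidef_def)
qed

lemma pos_semidef_mat_diag:
  assumes "\<And>i. i < n \<Longrightarrow> 0 \<le> f i"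
  shows "pos_semidef n (mat_diag n f)"
  unfolding pos_semidef_iff
proof (intro conjI allI)
  fix g :: "nat \<Rightarrow> complex"
  have "(\<Sum>i<n. \<Sum>j<n. mat_diag n f $$ (i, j) * g j * cnj (g i))
      = (\<Sum>i<n. f i * (g i * cnj (g i)))"
    by (intro sum.cong refl) (simp add: mat_diag_def if_distrib[of "\<lambda>x. x * _"] cong: if_cong)
  also have "\<dots> \<ge> 0"
  proof (intro sum_nonneg)
    fix i assume "i \<in> {..<n}"
    then have "0 \<le> f i" using assms by simp
    moreover have "0 \<le> g i * cnj (g i)" by (simp add: less_eq_complex_def)
    ultimately show "0 \<le> f i * (g i * cnj (g i))" by (rule mult_nonneg_nonneg)
  qed
  finally show "0 \<le> (\<Sum>i<n. \<Sum>j<n. mat_diag n f $$ (i, j) * g j * cnj (g i))" .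
qed simp

section \<open>Traces, roots of the characteristic polynomial and eigenvalue lists\<close>

lemma mtrace_mult_commute:
  assumes "A \<in> carrier_mat m n" "B \<in> carrier_mat n m"
  shows "mtrace (A * B) = mtrace (B * A)"
proof -
  have "mtrace (A * B) = (\<Sum>i<m. \<Sum>k<n. A $$ (i, k) * B $$ (k, i))"
    using assms index_mult_mat_sum[OF assms] by (simp add: mtrace_def)
  also have "\<dots> = (\<Sum>k<n. \<Sum>i<m. B $$ (k, i) * A $$ (i, k))"
    by (subst sum.swap) (simp add: mult.commute)
  also have "\<dots> = mtrace (B * A)"
    using assms index_mult_mat_sum[OF assms(2,1)] by (simp add: mtrace_def)
  finally show ?thesis .
qed

lemma mtrace_unitary_conj:
  assumes U: "unitary_mat n U" and A: "A \<in> carrier_mat n n"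
  shows "mtrace (U * A * mat_adjoint U) = mtrace A"
proof -
  note u = unitary_matD[OF U]
  have "mtrace (U * A * mat_adjoint U) = mtrace (mat_adjoint U * (U * A))"
    by (rule mtrace_mult_commute) (use u A in auto)
  then show ?thesis by (simp add: unitary_mat_cancel[OF U A])
qed

lemma mtrace_mat_diag: "mtrace (mat_diag n f) = (\<Sum>i<n. f i)"
  by (simp add: mtrace_def mat_diag_def)

text \<open>Bridges the multiset of roots, in terms of which \<open>eigvals_decr\<close> and
  \<open>trace_norm\<close> are defined, and the list of linear factors that
  \<open>hermitian_spectral\<close> expects.\<close>

lemma char_poly_eq_prod_list:
  fixes A :: "complex mat"
  assumes A: "A \<in> carrier_mat n n" and es: "mset es = proots (char_poly A)"
  shows "char_poly A = (\<Prod>e\<leftarrow>es. [:- e, 1:])" "length es = n"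
proof -
  have deg: "degree (char_poly A) = n" "lead_coeff (char_poly A) = 1"
    using degree_monic_char_poly[OF A] by auto
  have "(\<Prod>e\<leftarrow>es. [:- e, 1:]) = (\<Prod>e\<in>#proots (char_poly A). [:- e, 1:])"
    by (subst prod_mset_prod_list [symmetric]) (simp add: es)
  then show "char_poly A = (\<Prod>e\<leftarrow>es. [:- e, 1:])"
    using complex_poly_decompose_multiset[of "char_poly A"] deg by simp
  have "length es = size (proots (char_poly A))" by (simp flip: es)
  then show "length es = n" using size_proots_complex[of "char_poly A"] deg by simp
qed

lemma proots_prod_linear: "proots (\<Prod>x\<leftarrow>xs. [:- f x, 1:]) = mset (map f xs)"
  for f :: "'a \<Rightarrow> 'b :: idom"
proof (induction xs)
  case (Cons x xs)
  have "(\<Prod>x\<leftarrow>xs. [:- f x, 1:]) \<noteq> 0" by (auto simp: prod_list_zero_iff)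
  then show ?case using Cons by (simp add: proots_mult del: mult_pCons_left)
qed simp

lemma proots_char_poly_mat_diag:
  fixes f :: "nat \<Rightarrow> complex"
  shows "proots (char_poly (mat_diag n f)) = mset (map f [0..<n])"
proof -
  have "char_poly (mat_diag n f) = (\<Prod>a\<leftarrow>diag_mat (mat_diag n f). [:- a, 1:])"
    by (rule char_poly_upper_triangular[of _ n]) (auto simp: mat_diag_def)
  also have "diag_mat (mat_diag n f) = map f [0..<n]"
    by (auto simp: diag_mat_def mat_diag_def)
  finally show ?thesis by (simp add: proots_prod_linear o_def)
qed

lemma proots_char_poly_diagonalized:
  assumes U: "unitary_mat n U"
  shows "proots (char_poly (U * mat_diag n f * mat_adjoint U)) = mset (map f [0..<n])"
  using char_poly_unitary_conj[OF U, of "mat_diag n f"] proots_char_poly_mat_diag[of n f] by simp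

text \<open>Undoing the diagonalization keeps the matrix positive semidefinite and puts every root
  on its diagonal, where entries are nonnegative.\<close>

lemma pos_semidef_proots_nonneg:
  assumes A: "pos_semidef n A" and x: "x \<in># proots (char_poly A)"
  shows "0 \<le> x"
proof -
  note c = pos_semidef_carrier[OF A]
  obtain es where es: "mset es = proots (char_poly A)" using ex_mset by blast
  note cp = char_poly_eq_prod_list[OF c es]
  obtain U where U: "unitary_mat n U" "A = U * mat_diag n (\<lambda>i. es ! i) * mat_adjoint U"
    using hermitian_spectral[OF c pos_semidef_hermitian[OF A] cp(1)] by blast
  have "mat_adjoint U * A * U = mat_diag n (\<lambda>i. es ! i)"
    unfolding U(2) by (rule unitary_conj_cancel(2)[OF U(1)]) simp
  then have psd: "pos_semidef n (mat_diag n (\<lambda>i. es ! i))"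
    using pos_semidef_conj[OF A unitary_matD(2)[OF U(1)]] by simp
  have "x \<in> set es" using x by (simp flip: es)
  then obtain i where i: "i < n" "es ! i = x" using cp(2) by (auto simp: in_set_conv_nth)
  show ?thesis using pos_semidef_diag_nonneg[OF psd i(1)] i by (simp add: mat_diag_def)
qed

lemma pos_semidef_spectral:
  assumes A: "pos_semidef n A"
  shows "length (eigvals_decr A) = n"
    and "\<And>i j. i \<le> j \<Longrightarrow> j < n \<Longrightarrow> eigvals_decr A ! j \<le> eigvals_decr A ! i"
    and "\<exists>U. unitary_mat n U \<and>
      A = U * mat_diag n (\<lambda>i. complex_of_real (eigvals_decr A ! i)) * mat_adjoint U"
proof -
  note c = pos_semidef_carrier[OF A]
  let ?es = "map complex_of_real (eigvals_decr A)"
  \<comment> \<open>\<open>eigvals_decr\<close> keeps only real parts. Nonnegativity in the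
    componentwise order makes the roots real, so embedding the list back into the complex numbers
    recovers the same multiset.\<close>
  have "mset ?es = image_mset (\<lambda>x. complex_of_real (Re x)) (proots (char_poly A))"
    by (simp add: eigvals_decr_def multiset.map_comp o_def)
  also have "\<dots> = image_mset (\<lambda>x. x) (proots (char_poly A))"
    using pos_semidef_proots_nonneg[OF A]
    by (intro image_mset_cong) (auto simp: less_eq_complex_def complex_eq_iff)
  finally have es: "mset ?es = proots (char_poly A)" by simp
  note cp = char_poly_eq_prod_list[OF c es]
  show len: "length (eigvals_decr A) = n" using cp(2) by simp
  have "sorted_wrt (\<ge>) (eigvals_decr A)"
    by (simp add: eigvals_decr_def sorted_wrt_rev)
  then show "eigvals_decr A ! j \<le> eigvals_decr A ! i" if "i \<le> j" "j < n" for i j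
    using that len by (cases "i = j") (auto simp: sorted_wrt_iff_nth_less)
  have "mat_diag n (\<lambda>i. ?es ! i) = mat_diag n (\<lambda>i. complex_of_real (eigvals_decr A ! i))"
    by (rule eq_matI) (use len in \<open>auto simp: mat_diag_def\<close>)
  then show "\<exists>U. unitary_mat n U \<and>
      A = U * mat_diag n (\<lambda>i. complex_of_real (eigvals_decr A ! i)) * mat_adjoint U"
    using hermitian_spectral[OF c pos_semidef_hermitian[OF A] cp(1)] by simp
qed

section \<open>The trace norm\<close>

lemma trace_norm_unitary_conj:
  assumes U: "unitary_mat n U" and A: "A \<in> carrier_mat n n"
  shows "trace_norm (U * A * mat_adjoint U) = trace_norm A"
proof -
  note u = unitary_matD[OF U] and Aa = mat_adjoint_carrier[OF A]
  let ?B = "U * A * mat_adjoint U"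
  have "mat_adjoint ?B * ?B = U * (mat_adjoint A * (mat_adjoint U * (U * (A * mat_adjoint U))))"
    using u(1,2) A Aa
    by (simp add: mat_adjoint_mult[of _ n n _ n] assoc_mult_mat[of _ n n _ n _ n])
  also have "\<dots> = U * (mat_adjoint A * A) * mat_adjoint U"
    using u(1,2) A Aa unitary_mat_cancel(2)[OF U, of "A * mat_adjoint U" n]
    by (simp add: assoc_mult_mat[of _ n n _ n _ n])
  finally show ?thesis
    using A Aa by (simp add: trace_norm_def char_poly_unitary_conj[OF U])
qed

lemma trace_norm_diagonal:
  assumes U: "unitary_mat n U"
  shows "trace_norm (U * mat_diag n (\<lambda>i. complex_of_real (f i)) * mat_adjoint U) = (\<Sum>i<n. \<bar>f i\<bar>)"
proof -
  have a: "mat_adjoint (mat_diag n (\<lambda>i. complex_of_real (f i))) = mat_diag n (\<lambda>i. complex_of_real (f i))"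
    by (rule eq_matI) (auto simp: mat_diag_def)
  have "trace_norm (U * mat_diag n (\<lambda>i. complex_of_real (f i)) * mat_adjoint U)
      = trace_norm (mat_diag n (\<lambda>i. complex_of_real (f i)))"
    by (rule trace_norm_unitary_conj[OF U]) simp
  also have "\<dots> = (\<Sum>i<n. sqrt (f i * f i))"
    unfolding trace_norm_def a mat_diag_diag proots_char_poly_mat_diag
    by (simp add: multiset.map_comp o_def atLeast0LessThan sum_unfold_sum_mset)
  finally show ?thesis by simp
qed

lemma pos_semidef_gram:
  fixes F :: "complex mat"
  assumes F: "F \<in> carrier_mat m n"
  shows "pos_semidef n (mat_adjoint F * F)"
proof -
  have "pos_semidef m (1\<^sub>m m)"
    using pos_semidef_mat_diag[of m "\<lambda>_. 1"] by (simp add: less_eq_complex_def)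
  from pos_semidef_conj[OF this mat_adjoint_carrier[OF F]] show ?thesis using F by simp
qed

text \<open>The squared modulus of the entry is at most the squared norm of column \<open>i\<close>,
  which is a diagonal entry of \<open>mat_adjoint F * F\<close>. In an eigenbasis that entry is a
  convex combination of squared singular values, each at most the square of their sum.\<close>

lemma cmod_diag_le_trace_norm:
  assumes F: "F \<in> carrier_mat n n" and i: "i < n"
  shows "cmod (F $$ (i, i)) \<le> trace_norm F"
proof -
  define G where "G = mat_adjoint F * F"
  have G: "pos_semidef n G" unfolding G_def by (rule pos_semidef_gram[OF F])
  define s where "s i = eigvals_decr G ! i" for i
  obtain Q where Q: "unitary_mat n Q"
    and GQ: "G = Q * mat_diag n (\<lambda>i. complex_of_real (s i)) * mat_adjoint Q"
    using pos_semidef_spectral(3)[OF G] unfolding s_def by blast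
  note q = unitary_matD[OF Q]
  have pr: "proots (char_poly G) = mset (map (\<lambda>i. complex_of_real (s i)) [0..<n])"
    unfolding GQ by (rule proots_char_poly_diagonalized[OF Q])
  have s0: "0 \<le> s k" if "k < n" for k
  proof -
    have "complex_of_real (s k) \<in># proots (char_poly G)" using that by (auto simp: pr)
    from pos_semidef_proots_nonneg[OF G this] show ?thesis by (simp add: less_eq_complex_def)
  qed
  have tn: "trace_norm F = (\<Sum>k<n. sqrt (s k))"
    unfolding trace_norm_def G_def[symmetric] pr
    by (simp add: multiset.map_comp o_def atLeast0LessThan sum_unfold_sum_mset)
  have t0: "0 \<le> trace_norm F" unfolding tn using s0 by (intro sum_nonneg) auto
  have s_le: "s k \<le> (trace_norm F)\<^sup>2" if k: "k < n" for k
  proof -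
    have "sqrt (s k) \<le> trace_norm F"
      unfolding tn using k s0 by (intro member_le_sum) auto
    then show ?thesis using s0[OF k] real_sqrt_le_iff sqrt_le_D by blast
  qed
  have sq: "(complex_of_real (cmod z))\<^sup>2 = z * cnj z" for z
    by (metis complex_norm_square of_real_power)
  have "(cmod (F $$ (i, i)))\<^sup>2 \<le> (\<Sum>k<n. (cmod (F $$ (k, i)))\<^sup>2)"
    using i by (intro member_le_sum) auto
  also have "\<dots> = Re (\<Sum>k<n. complex_of_real ((cmod (F $$ (k, i)))\<^sup>2))" by simp
  also have "(\<Sum>k<n. complex_of_real ((cmod (F $$ (k, i)))\<^sup>2)) = G $$ (i, i)"
    unfolding G_def
    by (subst index_mult_mat_sum[OF mat_adjoint_carrier[OF F] F i i])
      (use F i in \<open>auto simp: sq mult.commute intro!: sum.cong\<close>)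
  also have "G $$ (i, i) = (\<Sum>k<n. of_real (s k * (cmod (Q $$ (i, k)))\<^sup>2))"
    unfolding GQ
    by (subst index_mult_mat_sum[OF mult_carrier_mat[OF q(1) mat_diag_dim] q(2) i i])
      (use q(1) i in \<open>auto simp: mat_diag_mult_right[OF q(1)] sq mult_ac intro!: sum.cong\<close>)
  also have "Re \<dots> = (\<Sum>k<n. s k * (cmod (Q $$ (i, k)))\<^sup>2)" by simp
  also have "\<dots> \<le> (\<Sum>k<n. (trace_norm F)\<^sup>2 * (cmod (Q $$ (i, k)))\<^sup>2)"
    using s_le by (intro sum_mono mult_right_mono) auto
  also have "\<dots> = (trace_norm F)\<^sup>2 * (\<Sum>k<n. (cmod (Q $$ (i, k)))\<^sup>2)"
    by (simp add: sum_distrib_left)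
  \<comment> \<open>The weights of the convex combination form a row of a unitary matrix, so they
    add up to 1.\<close>
  also have "complex_of_real (\<Sum>k<n. (cmod (Q $$ (i, k)))\<^sup>2) = (Q * mat_adjoint Q) $$ (i, i)"
    by (subst index_mult_mat_sum[OF q(1,2) i i]) (use q(1) i in \<open>auto simp: sq\<close>)
  then have "(\<Sum>k<n. (cmod (Q $$ (i, k)))\<^sup>2) = 1"
    using q(3) i by (simp flip: of_real_sum add: of_real_eq_1_iff)
  finally show ?thesis using t0 by (simp add: abs_le_square_iff[symmetric])
qed

section \<open>Noisy operations are unital channels\<close>

lemma sum_lessThan_mult:
  fixes f :: "nat \<Rightarrow> 'a :: comm_monoid_add"
  shows "(\<Sum>p<a * b. f p) = (\<Sum>i<a. \<Sum>k<b. f (i * b + k))"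
proof -
  have "(\<Sum>p<a * b. f p) = (\<Sum>i<a. \<Sum>p\<in>{i * b..<i * b + b}. f p)"
    by (rule sum.nat_group[symmetric])
  also have "\<dots> = (\<Sum>i<a. \<Sum>k<b. f (i * b + k))"
  proof (rule sum.cong[OF refl])
    show "(\<Sum>p\<in>{i * b..<i * b + b}. f p) = (\<Sum>k<b. f (i * b + k))" for i
      by (rule sum.reindex_bij_witness[of _ "\<lambda>k. i * b + k" "\<lambda>p. p - i * b"]) auto
  qed
  finally show ?thesis .
qed

lemma mult_add_less:
  fixes i k a b :: nat
  assumes "i < a" "k < b"
  shows "i * b + k < a * b"
proof -
  have "i * b + k < Suc i * b" using assms by simp
  also have "\<dots> \<le> a * b" using assms by (intro mult_le_mono1) auto
  finally show ?thesis .
qed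

text \<open>Linearity is demanded on all square matrices because the comparison argument applies the
  map to matrices that are not states. The factor \<open>m / n\<close> in \<open>one\<close> is the
  one forced by preservation of the trace; \<open>dim_pos\<close> keeps the intermediate dimension
  nonzero, so that these factors cancel under composition.\<close>

locale unital_channel =
  fixes m n :: nat and \<Lambda> :: "complex mat \<Rightarrow> complex mat"
  assumes carrier: "A \<in> carrier_mat m m \<Longrightarrow> \<Lambda> A \<in> carrier_mat n n"
    and add: "A \<in> carrier_mat m m \<Longrightarrow> B \<in> carrier_mat m m \<Longrightarrow> \<Lambda> (A + B) = \<Lambda> A + \<Lambda> B"
    and smult: "A \<in> carrier_mat m m \<Longrightarrow> \<Lambda> (c \<cdot>\<^sub>m A) = c \<cdot>\<^sub>m \<Lambda> A"
    and pos: "pos_semidef m A \<Longrightarrow> pos_semidef n (\<Lambda> A)"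
    and trace: "A \<in> carrier_mat m m \<Longrightarrow> mtrace (\<Lambda> A) = mtrace A"
    and dim_pos: "m > 0 \<Longrightarrow> n > 0"
    and one: "m > 0 \<Longrightarrow> \<Lambda> (1\<^sub>m m) = (of_nat m / of_nat n) \<cdot>\<^sub>m 1\<^sub>m n"

section \<open>The generating operations, one by one, and their composition\<close>

lemma unital_channel_unitary_conj:
  assumes U: "unitary_mat n U"
  shows "unital_channel n n (\<lambda>\<rho>. U * \<rho> * mat_adjoint U)"
proof unfold_locales
  note u = unitary_matD[OF U]
  fix A B :: "complex mat" and c assume A: "A \<in> carrier_mat n n"
  show "U * A * mat_adjoint U \<in> carrier_mat n n" using u A by auto
  show "mtrace (U * A * mat_adjoint U) = mtrace A" by (rule mtrace_unitary_conj[OF U A])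
  show "U * (c \<cdot>\<^sub>m A) * mat_adjoint U = c \<cdot>\<^sub>m (U * A * mat_adjoint U)"
    using u(1,2) A
    by (simp add: mult_smult_distrib[OF u(1) A] mult_smult_assoc_mat[of _ n n _ n])
  assume B: "B \<in> carrier_mat n n"
  show "U * (A + B) * mat_adjoint U = U * A * mat_adjoint U + U * B * mat_adjoint U"
    using u(1,2) A B
    by (simp add: mult_add_distrib_mat[OF u(1) A B] add_mult_distrib_mat[of _ n n _ _ n])
next
  fix A assume "pos_semidef n A"
  then show "pos_semidef n (U * A * mat_adjoint U)"
    by (rule pos_semidef_conj) (rule unitary_matD[OF U])
next
  assume "n > 0"
  have "U * 1\<^sub>m n * mat_adjoint U = 1\<^sub>m n" using unitary_matD[OF U] by simp
  then show "U * 1\<^sub>m n * mat_adjoint U = (of_nat n / of_nat n) \<cdot>\<^sub>m 1\<^sub>m n"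
    using \<open>n > 0\<close> by (auto intro!: eq_matI)
qed simp

lemma index_tensor_max_mixed:
  assumes "A \<in> carrier_mat n n" "i < n" "k < K" "j < n" "l < K"
  shows "tensor_mat A (max_mixed K) $$ (i * K + k, j * K + l)
    = (if k = l then A $$ (i, j) / of_nat K else 0)"
  using assms mult_add_less[of i n k K] mult_add_less[of j n l K]
  by (auto simp: tensor_mat_def max_mixed_def)

lemma tensor_max_mixed_carrier:
  "A \<in> carrier_mat n n \<Longrightarrow> tensor_mat A (max_mixed K) \<in> carrier_mat (n * K) (n * K)"
  by (auto simp: tensor_mat_def max_mixed_def)

lemma unital_channel_ancilla:
  assumes K: "K > 0"
  shows "unital_channel n (n * K) (\<lambda>\<rho>. tensor_mat \<rho> (max_mixed K))"
proof unfold_locales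
  have mod: "p mod K < K" "q < n * K \<Longrightarrow> q div K < n" for p q
    using K by (auto simp: less_mult_imp_div_less)
  fix A B :: "complex mat" and c assume A: "A \<in> carrier_mat n n"
  show "tensor_mat A (max_mixed K) \<in> carrier_mat (n * K) (n * K)"
    by (rule tensor_max_mixed_carrier[OF A])
  show "tensor_mat (c \<cdot>\<^sub>m A) (max_mixed K) = c \<cdot>\<^sub>m tensor_mat A (max_mixed K)"
    by (rule eq_matI) (use A mod in \<open>auto simp: tensor_mat_def max_mixed_def\<close>)
  show "mtrace (tensor_mat A (max_mixed K)) = mtrace A"
  proof -
    have "mtrace (tensor_mat A (max_mixed K))
        = (\<Sum>i<n. \<Sum>k<K. tensor_mat A (max_mixed K) $$ (i * K + k, i * K + k))"
      using tensor_max_mixed_carrier[OF A, of K] by (simp add: mtrace_def sum_lessThan_mult)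
    also have "\<dots> = (\<Sum>i<n. \<Sum>k<K. A $$ (i, i) / of_nat K)"
      by (intro sum.cong refl) (simp add: index_tensor_max_mixed[OF A])
    also have "\<dots> = mtrace A" using A K by (simp add: mtrace_def)
    finally show ?thesis .
  qed
  assume B: "B \<in> carrier_mat n n"
  show "tensor_mat (A + B) (max_mixed K) = tensor_mat A (max_mixed K) + tensor_mat B (max_mixed K)"
    by (rule eq_matI) (use A B mod in \<open>auto simp: tensor_mat_def max_mixed_def add_divide_distrib\<close>)
next
  fix A assume A: "pos_semidef n A"
  note c = pos_semidef_carrier[OF A]
  show "pos_semidef (n * K) (tensor_mat A (max_mixed K))"
    unfolding pos_semidef_iff
  proof (intro conjI allI tensor_max_mixed_carrier[OF c])
    fix f :: "nat \<Rightarrow> complex"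
    \<comment> \<open>The ancilla is diagonal, so the form splits into \<open>K\<close> forms of
      \<open>A\<close>, the one for level \<open>k\<close> being tested on the slice
      \<open>\<lambda>i. f (i * K + k)\<close>.\<close>
    have "(\<Sum>p<n * K. \<Sum>q<n * K. tensor_mat A (max_mixed K) $$ (p, q) * f q * cnj (f p))
      = (\<Sum>i<n. \<Sum>k<K. \<Sum>j<n. \<Sum>l<K. tensor_mat A (max_mixed K) $$ (i * K + k, j * K + l)
          * f (j * K + l) * cnj (f (i * K + k)))"
      by (simp add: sum_lessThan_mult)
    also have "\<dots> = (\<Sum>i<n. \<Sum>k<K. \<Sum>j<n. \<Sum>l<K. if k = l then
        A $$ (i, j) * f (j * K + l) * cnj (f (i * K + k)) / of_nat K else 0)"
      by (intro sum.cong refl) (simp add: index_tensor_max_mixed[OF c])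
    also have "\<dots> = (\<Sum>i<n. \<Sum>k<K. \<Sum>j<n.
        A $$ (i, j) * f (j * K + k) * cnj (f (i * K + k)) / of_nat K)"
      by (intro sum.cong refl) simp
    also have "\<dots> = (\<Sum>k<K. \<Sum>i<n. \<Sum>j<n.
        A $$ (i, j) * f (j * K + k) * cnj (f (i * K + k)) / of_nat K)"
      by (rule sum.swap)
    also have "\<dots> = (1 / of_nat K) * (\<Sum>k<K. \<Sum>i<n. \<Sum>j<n.
        A $$ (i, j) * f (j * K + k) * cnj (f (i * K + k)))"
      by (simp add: sum_divide_distrib)
    also have "\<dots> \<ge> 0"
    proof (rule mult_nonneg_nonneg)
      show "0 \<le> 1 / (of_nat K :: complex)" by (simp add: less_eq_complex_def)
      show "0 \<le> (\<Sum>k<K. \<Sum>i<n. \<Sum>j<n. A $$ (i, j) * f (j * K + k) * cnj (f (i * K + k)))"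
      proof (rule sum_nonneg)
        show "0 \<le> (\<Sum>i<n. \<Sum>j<n. A $$ (i, j) * f (j * K + k) * cnj (f (i * K + k)))" for k
          using A unfolding pos_semidef_iff by (auto dest: spec[of _ "\<lambda>i. f (i * K + k)"])
      qed
    qed
    finally show "0 \<le> (\<Sum>p<n * K. \<Sum>q<n * K.
        tensor_mat A (max_mixed K) $$ (p, q) * f q * cnj (f p))" .
  qed
next
  assume "n > 0"
  show "tensor_mat (1\<^sub>m n) (max_mixed K) = (of_nat n / of_nat (n * K)) \<cdot>\<^sub>m 1\<^sub>m (n * K)"
  proof (rule eq_matI)
    fix p q assume "p < dim_row ((of_nat n / of_nat (n * K)) \<cdot>\<^sub>m (1\<^sub>m (n * K) :: complex mat))"
      "q < dim_col ((of_nat n / of_nat (n * K)) \<cdot>\<^sub>m (1\<^sub>m (n * K) :: complex mat))"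
    then have pq: "p < n * K" "q < n * K" by auto
    then have "p div K < n" "q div K < n" "p mod K < K" "q mod K < K"
      using K by (auto simp: less_mult_imp_div_less)
    moreover have "p = q \<longleftrightarrow> p div K = q div K \<and> p mod K = q mod K"
      by (metis div_mult_mod_eq)
    ultimately show "tensor_mat (1\<^sub>m n) (max_mixed K) $$ (p, q)
        = ((of_nat n / of_nat (n * K)) \<cdot>\<^sub>m 1\<^sub>m (n * K)) $$ (p, q)"
      using pq \<open>n > 0\<close> by (simp add: tensor_mat_def max_mixed_def)
  qed (auto simp: tensor_mat_def max_mixed_def)
qed (use K in simp)

lemma unital_channel_partial_trace:
  assumes a: "a > 0" and b: "b > 0"
  shows "unital_channel (a * b) a (partial_trace a b)"
proof unfold_locales
  fix A B :: "complex mat" and c assume A: "A \<in> carrier_mat (a * b) (a * b)"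
  show "partial_trace a b A \<in> carrier_mat a a" by (simp add: partial_trace_def)
  show "partial_trace a b (c \<cdot>\<^sub>m A) = c \<cdot>\<^sub>m partial_trace a b A"
    by (rule eq_matI)
      (use A mult_add_less[of _ a _ b] in \<open>simp_all add: partial_trace_def sum_distrib_left\<close>)
  show "mtrace (partial_trace a b A) = mtrace A"
    using A by (simp add: mtrace_def partial_trace_def sum_lessThan_mult)
  assume B: "B \<in> carrier_mat (a * b) (a * b)"
  show "partial_trace a b (A + B) = partial_trace a b A + partial_trace a b B"
    by (rule eq_matI)
      (use A B mult_add_less[of _ a _ b] in \<open>simp_all add: partial_trace_def sum.distrib\<close>)
next
  fix A assume A: "pos_semidef (a * b) A"
  show "pos_semidef a (partial_trace a b A)"
    unfolding pos_semidef_iff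
  proof (intro conjI allI)
    fix f :: "nat \<Rightarrow> complex"
    \<comment> \<open>\<open>g k\<close> is the product of \<open>f\<close> with the basis vector
      \<open>k\<close> of the discarded factor; the form of the partial trace at \<open>f\<close> is
      the sum over \<open>k\<close> of the forms of \<open>A\<close> at these vectors.\<close>
    define g where "g k p = (if p mod b = k then f (p div b) else 0)" for k p
    have g: "g k (i * b + l) = (if l = k then f i else 0)" if "l < b" for k l i
      using that by (simp add: g_def)
    have "(\<Sum>i<a. \<Sum>j<a. partial_trace a b A $$ (i, j) * f j * cnj (f i))
        = (\<Sum>i<a. \<Sum>j<a. \<Sum>k<b. A $$ (i * b + k, j * b + k) * f j * cnj (f i))"
      by (intro sum.cong refl) (simp add: partial_trace_def sum_distrib_right)
    also have "\<dots> = (\<Sum>i<a. \<Sum>k<b. \<Sum>j<a. A $$ (i * b + k, j * b + k) * f j * cnj (f i))"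
      by (intro sum.cong refl sum.swap)
    also have "\<dots> = (\<Sum>k<b. \<Sum>i<a. \<Sum>j<a. A $$ (i * b + k, j * b + k) * f j * cnj (f i))"
      by (rule sum.swap)
    also have "\<dots> = (\<Sum>k<b. \<Sum>p<a * b. \<Sum>q<a * b. A $$ (p, q) * g k q * cnj (g k p))"
    proof (rule sum.cong[OF refl])
      fix k assume k: "k \<in> {..<b}"
      have "(\<Sum>p<a * b. \<Sum>q<a * b. A $$ (p, q) * g k q * cnj (g k p))
          = (\<Sum>i<a. \<Sum>l<b. \<Sum>j<a. \<Sum>h<b. if h = k then if l = k then
              A $$ (i * b + l, j * b + h) * f j * cnj (f i) else 0 else 0)"
        unfolding sum_lessThan_mult by (intro sum.cong refl) (simp add: g)
      also have "\<dots> = (\<Sum>i<a. \<Sum>l<b. if l = k then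
          \<Sum>j<a. A $$ (i * b + l, j * b + k) * f j * cnj (f i) else 0)"
        using k by (intro sum.cong refl) simp
      also have "\<dots> = (\<Sum>i<a. \<Sum>j<a. A $$ (i * b + k, j * b + k) * f j * cnj (f i))"
        using k by simp
      finally show "(\<Sum>i<a. \<Sum>j<a. A $$ (i * b + k, j * b + k) * f j * cnj (f i))
          = (\<Sum>p<a * b. \<Sum>q<a * b. A $$ (p, q) * g k q * cnj (g k p))" ..
    qed
    also have "\<dots> \<ge> 0" using A by (intro sum_nonneg[of "{..<b}"]) (simp add: pos_semidef_iff)
    finally show "0 \<le> (\<Sum>i<a. \<Sum>j<a. partial_trace a b A $$ (i, j) * f j * cnj (f i))" .
  qed (simp add: partial_trace_def)
next
  show "partial_trace a b (1\<^sub>m (a * b)) = (of_nat (a * b) / of_nat a) \<cdot>\<^sub>m 1\<^sub>m a"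
    by (rule eq_matI) (use a b in \<open>auto simp: partial_trace_def mult_add_less\<close>)
qed (use a in simp)

lemma unital_channel_compose:
  assumes "unital_channel l m \<Lambda>" "unital_channel m n \<Gamma>"
  shows "unital_channel l n (\<Gamma> \<circ> \<Lambda>)"
proof -
  interpret A: unital_channel l m \<Lambda> by fact
  interpret B: unital_channel m n \<Gamma> by fact
  show ?thesis
  proof unfold_locales
    assume "l > 0"
    then have m: "m > 0" by (rule A.dim_pos)
    have "\<Gamma> ((of_nat l / of_nat m) \<cdot>\<^sub>m 1\<^sub>m m) = (of_nat l / of_nat m) \<cdot>\<^sub>m \<Gamma> (1\<^sub>m m)"
      by (rule B.smult) simp
    then show "(\<Gamma> \<circ> \<Lambda>) (1\<^sub>m l) = (of_nat l / of_nat n) \<cdot>\<^sub>m 1\<^sub>m n"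
      using m \<open>l > 0\<close> by (auto simp: A.one B.one intro!: eq_matI)
  qed (auto simp: A.carrier A.add A.smult A.pos A.trace A.dim_pos
      B.carrier B.add B.smult B.pos B.trace B.dim_pos)
qed

lemma noisy_op_unital_channel:
  "noisy_op m n \<Lambda> \<Longrightarrow> unital_channel m n \<Lambda>"
proof (induction rule: noisy_op.induct)
  case (discard a b V)
  then show ?case
    using unital_channel_compose[OF unital_channel_unitary_conj unital_channel_partial_trace]
    by (simp add: o_def)
next
  case (compose l m \<Lambda> n \<Gamma>)
  then show ?case using unital_channel_compose by blast
qed (auto intro: unital_channel_unitary_conj unital_channel_ancilla)

section \<open>Noisy operations increase mixedness\<close>

text \<open>The threshold is the last summed entry itself: later entries have no positive part above
  it and earlier ones are never cut off. Ties contribute zero on either side.\<close>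

lemma sum_max_zero_le:
  fixes \<mu> :: "nat \<Rightarrow> real"
  assumes dec: "\<And>i j. i \<le> j \<Longrightarrow> j < d \<Longrightarrow> \<mu> j \<le> \<mu> i" and k: "Suc k \<le> d"
  shows "(\<Sum>i<d. max 0 (\<mu> i - \<mu> k)) = (\<Sum>i<Suc k. \<mu> i) - real (Suc k) * \<mu> k"
proof -
  have "(\<Sum>i<d. max 0 (\<mu> i - \<mu> k)) = (\<Sum>i<Suc k. \<mu> i - \<mu> k)"
  proof (rule sum.mono_neutral_cong_right)
    show "\<forall>i\<in>{..<d} - {..<Suc k}. max 0 (\<mu> i - \<mu> k) = 0"
      using dec[of k] by (auto simp: max_def not_less Suc_le_eq less_imp_le order.antisym)
    show "max 0 (\<mu> i - \<mu> k) = \<mu> i - \<mu> k" if "i \<in> {..<Suc k}" for i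
      using dec[of i k] that k by (simp add: max_def)
  qed (use k in auto)
  then show ?thesis by (simp add: sum_subtractf del: sum.lessThan_Suc)
qed

text \<open>With \<open>t\<close> the last of the summed eigenvalues, \<open>\<rho> + (\<rho> - t)\<^sub>- = t + (\<rho> - t)\<^sub>+\<close> and the trace of
  \<open>(\<rho> - t)\<^sub>+\<close> is the sum of the leading eigenvalues minus \<open>Suc k * t\<close>; a unital channel preserves
  this identity, so the diagonal of the output can be compared with no variational principle.\<close>

lemma unital_channel_diag_sum_le:
  assumes \<rho>: "pos_semidef d \<rho>" and \<Lambda>: "unital_channel d d \<Lambda>" and k: "Suc k \<le> d"
  shows "(\<Sum>i<Suc k. Re (\<Lambda> \<rho> $$ (i, i))) \<le> (\<Sum>i<Suc k. eigvals_decr \<rho> ! i)"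
proof -
  interpret unital_channel d d \<Lambda> by fact
  define \<mu> where "\<mu> i = eigvals_decr \<rho> ! i" for i
  define t where "t = \<mu> k"
  obtain U where U: "unitary_mat d U"
    and \<rho>_eq: "\<rho> = U * mat_diag d (\<lambda>i. complex_of_real (\<mu> i)) * mat_adjoint U"
    using pos_semidef_spectral(3)[OF \<rho>] unfolding \<mu>_def by blast
  note u = unitary_matD[OF U]
  \<comment> \<open>Functional calculus in the eigenbasis of \<open>\<rho>\<close>: identities
    between matrices \<open>D f\<close> reduce to identities between real functions.\<close>
  define D where "D f = U * mat_diag d (\<lambda>i. complex_of_real (f i)) * mat_adjoint U"
    for f :: "nat \<Rightarrow> real"
  interpret C: unital_channel d d "\<lambda>\<rho>. U * \<rho> * mat_adjoint U"
    by (rule unital_channel_unitary_conj[OF U])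
  have D_carrier: "D f \<in> carrier_mat d d" for f unfolding D_def by (rule C.carrier) simp
  have D_add: "D f + D g = D (\<lambda>i. f i + g i)" for f g
  proof -
    have "mat_diag d (\<lambda>i. complex_of_real (f i)) + mat_diag d (\<lambda>i. complex_of_real (g i))
        = mat_diag d (\<lambda>i. complex_of_real (f i + g i))"
      by (rule eq_matI) (auto simp: mat_diag_def)
    then show ?thesis unfolding D_def by (subst C.add[symmetric]) auto
  qed
  have D_const: "D (\<lambda>_. c) = complex_of_real c \<cdot>\<^sub>m 1\<^sub>m d" for c
  proof -
    have "mat_diag d (\<lambda>i. complex_of_real c) = complex_of_real c \<cdot>\<^sub>m 1\<^sub>m d"
      by (rule eq_matI) (auto simp: mat_diag_def)
    then show ?thesis unfolding D_def using C.smult[of "1\<^sub>m d" "complex_of_real c"] u by simp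
  qed
  have D_pos: "pos_semidef d (D f)" if "\<And>i. 0 \<le> f i" for f
    unfolding D_def by (intro C.pos pos_semidef_mat_diag) (simp add: that less_eq_complex_def)
  define P N where "P = D (\<lambda>i. max 0 (\<mu> i - t))" and "N = D (\<lambda>i. max 0 (t - \<mu> i))"
  have "\<rho> + N = complex_of_real t \<cdot>\<^sub>m 1\<^sub>m d + P"
    unfolding \<rho>_eq[folded D_def] N_def P_def D_const[symmetric] D_add
    by (rule arg_cong[of _ _ D]) (auto simp: max_def)
  then have "\<Lambda> (\<rho> + N) = \<Lambda> (complex_of_real t \<cdot>\<^sub>m 1\<^sub>m d + P)" by simp
  moreover have "\<Lambda> (1\<^sub>m d) = 1\<^sub>m d" using one k by (auto intro!: eq_matI)
  ultimately have eq: "\<Lambda> \<rho> + \<Lambda> N = complex_of_real t \<cdot>\<^sub>m 1\<^sub>m d + \<Lambda> P"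
    using k pos_semidef_carrier[OF \<rho>] D_carrier
    by (simp add: add smult N_def P_def)
  have PN: "pos_semidef d (\<Lambda> P)" "pos_semidef d (\<Lambda> N)"
    unfolding P_def N_def by (auto intro!: pos D_pos)
  note car = PN[THEN pos_semidef_carrier] carrier[OF pos_semidef_carrier[OF \<rho>]]
  have "Re (\<Lambda> \<rho> $$ (i, i)) \<le> t + Re (\<Lambda> P $$ (i, i))" if i: "i < d" for i
  proof -
    have "Re ((\<Lambda> \<rho> + \<Lambda> N) $$ (i, i)) = Re ((complex_of_real t \<cdot>\<^sub>m 1\<^sub>m d + \<Lambda> P) $$ (i, i))"
      by (simp add: eq)
    then have "Re (\<Lambda> \<rho> $$ (i, i)) + Re (\<Lambda> N $$ (i, i)) = t + Re (\<Lambda> P $$ (i, i))"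
      using i car by simp
    then show ?thesis using pos_semidef_diag_nonneg[OF PN(2) i] by (simp add: less_eq_complex_def)
  qed
  then have "(\<Sum>i<Suc k. Re (\<Lambda> \<rho> $$ (i, i))) \<le> (\<Sum>i<Suc k. t + Re (\<Lambda> P $$ (i, i)))"
    using k by (intro sum_mono) auto
  also have "\<dots> = real (Suc k) * t + (\<Sum>i<Suc k. Re (\<Lambda> P $$ (i, i)))"
    by (simp add: sum.distrib del: sum.lessThan_Suc)
  \<comment> \<open>Positivity of \<open>\<Lambda> P\<close> allows completing the partial sum to
    the full trace, which the channel preserves and which is known from the spectrum of
    \<open>\<rho>\<close>.\<close>
  also have "(\<Sum>i<Suc k. Re (\<Lambda> P $$ (i, i))) \<le> (\<Sum>i<d. Re (\<Lambda> P $$ (i, i)))"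
    using k pos_semidef_diag_nonneg[OF PN(1)]
    by (intro sum_mono2) (auto simp: less_eq_complex_def)
  also have "\<dots> = Re (mtrace (\<Lambda> P))" using car by (simp add: mtrace_def)
  also have "mtrace (\<Lambda> P) = mtrace P" unfolding P_def by (rule trace[OF D_carrier])
  also have "\<dots> = (\<Sum>i<d. complex_of_real (max 0 (\<mu> i - t)))"
    unfolding P_def D_def by (subst C.trace) (simp_all add: mtrace_mat_diag)
  also have "Re \<dots> = (\<Sum>i<d. max 0 (\<mu> i - t))" by simp
  also have "\<dots> = (\<Sum>i<Suc k. \<mu> i) - real (Suc k) * t"
    unfolding t_def
    by (rule sum_max_zero_le[OF _ k]) (use pos_semidef_spectral(2)[OF \<rho>] in \<open>auto simp: \<mu>_def\<close>)
  finally show ?thesis by (simp add: \<mu>_def del: sum.lessThan_Suc)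
qed

lemma no_transition_imp_more_mixed:
  assumes \<rho>: "pos_semidef d \<rho>" and \<sigma>: "pos_semidef d \<sigma>" and trans: "no_transition d \<rho> \<sigma>"
  shows "more_mixed d \<sigma> \<rho>"
  unfolding more_mixed_def
proof (intro allI impI)
  fix k assume k: "k \<le> d"
  show "(\<Sum>i<k. eigvals_decr \<sigma> ! i) \<le> (\<Sum>i<k. eigvals_decr \<rho> ! i)"
  proof (cases k)
    case (Suc k')
    obtain V where V: "unitary_mat d V" and
      \<sigma>_eq: "\<sigma> = V * mat_diag d (\<lambda>i. complex_of_real (eigvals_decr \<sigma> ! i)) * mat_adjoint V"
      using pos_semidef_spectral(3)[OF \<sigma>] by blast
    note v = unitary_matD[OF V] and c = pos_semidef_carrier[OF \<sigma>]
    show ?thesis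
    proof (rule field_le_epsilon)
      fix e :: real assume e: "e > 0"
      \<comment> \<open>The tolerance is divided by \<open>k\<close> because the errors of
        \<open>k\<close> diagonal entries will be added.\<close>
      have "e / real k > 0" using e Suc by simp
      then obtain \<Lambda> where \<Lambda>: "noisy_op d d \<Lambda>" and close: "trace_norm (\<Lambda> \<rho> - \<sigma>) \<le> e / real k"
        using trans unfolding no_transition_def by blast
      interpret unital_channel d d \<Lambda> by (rule noisy_op_unital_channel[OF \<Lambda>])
      \<comment> \<open>Rotating the output into an eigenbasis of \<open>\<sigma>\<close> keeps the
        map a unital channel and places the eigenvalues of \<open>\<sigma>\<close> on the diagonal,
        so diagonal entries can be compared directly.\<close>
      define \<Gamma> where "\<Gamma> = (\<lambda>A. mat_adjoint V * A * V) \<circ> \<Lambda>"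
      have "unital_channel d d (\<lambda>A. mat_adjoint V * A * V)"
        using unital_channel_unitary_conj[OF unitary_mat_adjoint[OF V]] by simp
      then have \<Gamma>: "unital_channel d d \<Gamma>"
        unfolding \<Gamma>_def by (intro unital_channel_compose[OF unital_channel_axioms])
      have car: "\<Lambda> \<rho> \<in> carrier_mat d d" by (rule carrier[OF pos_semidef_carrier[OF \<rho>]])
      define F where "F = mat_adjoint V * (\<Lambda> \<rho> - \<sigma>) * V"
      have F: "F \<in> carrier_mat d d" unfolding F_def
        by (rule mult_carrier_mat[OF mult_carrier_mat[OF v(2) minus_carrier_mat[OF c]] v(1)])
      have "trace_norm F = trace_norm (\<Lambda> \<rho> - \<sigma>)"
        using trace_norm_unitary_conj[OF unitary_mat_adjoint[OF V], of "\<Lambda> \<rho> - \<sigma>"] c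
        by (simp add: F_def minus_carrier_mat)
      then have Fd: "cmod (F $$ (i, i)) \<le> e / real k" if "i < d" for i
        using cmod_diag_le_trace_norm[OF F that] close by simp
      have "mat_adjoint V * \<sigma> * V = mat_diag d (\<lambda>i. complex_of_real (eigvals_decr \<sigma> ! i))"
        by (subst \<sigma>_eq, rule unitary_conj_cancel(2)[OF V]) simp
      moreover have "F = \<Gamma> \<rho> - mat_adjoint V * \<sigma> * V"
        unfolding F_def \<Gamma>_def o_def mult_minus_distrib_mat[OF v(2) car c]
        by (rule minus_mult_distrib_mat[OF mult_carrier_mat[OF v(2) car]
              mult_carrier_mat[OF v(2) c] v(1)])
      ultimately have F_eq: "F = \<Gamma> \<rho> - mat_diag d (\<lambda>i. complex_of_real (eigvals_decr \<sigma> ! i))"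
        by simp
      have "eigvals_decr \<sigma> ! i \<le> Re (\<Gamma> \<rho> $$ (i, i)) + e / real k" if i: "i < d" for i
      proof -
        have "Re (F $$ (i, i)) = Re (\<Gamma> \<rho> $$ (i, i)) - eigvals_decr \<sigma> ! i"
          using i unfolding F_eq by (simp add: mat_diag_def)
        moreover have "\<bar>Re (F $$ (i, i))\<bar> \<le> e / real k"
          using Fd[OF i] abs_Re_le_cmod[of "F $$ (i, i)"] by linarith
        ultimately show ?thesis by linarith
      qed
      then have "(\<Sum>i<k. eigvals_decr \<sigma> ! i) \<le> (\<Sum>i<k. Re (\<Gamma> \<rho> $$ (i, i)) + e / real k)"
        using k by (intro sum_mono) auto
      also have "\<dots> = (\<Sum>i<k. Re (\<Gamma> \<rho> $$ (i, i))) + e"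
        using Suc by (simp add: sum.distrib del: sum.lessThan_Suc)
      also have "\<dots> \<le> (\<Sum>i<k. eigvals_decr \<rho> ! i) + e"
        using unital_channel_diag_sum_le[OF \<rho> \<Gamma>, of k'] k Suc by simp
      finally show "(\<Sum>i<k. eigvals_decr \<sigma> ! i) \<le> (\<Sum>i<k. eigvals_decr \<rho> ! i) + e" .
    qed
  qed simp
qed

section \<open>Realizing a majorization by T-transforms\<close>

text \<open>The average of the identity and a transposition, with \<open>t\<close> the weight of the
  transposition.\<close>

definition t_transform :: "nat \<Rightarrow> nat \<Rightarrow> real \<Rightarrow> (nat \<Rightarrow> real) \<Rightarrow> nat \<Rightarrow> real" where
  "t_transform i j t x l =
    (if l = i then (1 - t) * x i + t * x j else if l = j then t * x i + (1 - t) * x j else x l)"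

text \<open>The Hardy-Littlewood-Polya theorem as an induction principle, so that no list of
  transforms has to be built. Each step makes at least one more position agree with the target.
  Sortedness is asked of the target alone and need not be maintained along the way;
  \<open>cong\<close> expresses that values beyond \<open>d\<close> are irrelevant.\<close>

lemma majorization_t_transform_induct:
  fixes \<nu> \<mu> :: "nat \<Rightarrow> real"
  assumes dec: "\<And>i j. i \<le> j \<Longrightarrow> j < d \<Longrightarrow> \<nu> j \<le> \<nu> i"
    and maj: "\<And>k. k \<le> d \<Longrightarrow> (\<Sum>i<k. \<nu> i) \<le> (\<Sum>i<k. \<mu> i)"
    and total: "(\<Sum>i<d. \<nu> i) = (\<Sum>i<d. \<mu> i)"
    and P: "P \<mu>"
    and cong: "\<And>x y. P x \<Longrightarrow> (\<And>i. i < d \<Longrightarrow> x i = y i) \<Longrightarrow> P y"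
    and step: "\<And>x i j t. P x \<Longrightarrow> i < d \<Longrightarrow> j < d \<Longrightarrow> i \<noteq> j \<Longrightarrow> 0 \<le> t \<Longrightarrow> t \<le> 1 \<Longrightarrow>
      P (t_transform i j t x)"
  shows "P \<nu>"
  using maj total P
proof (induction "card {i. i < d \<and> \<nu> i \<noteq> \<mu> i}" arbitrary: \<mu> rule: less_induct)
  case less
  note maj = less.prems(1) and total = less.prems(2)
  show ?case
  proof (cases "\<exists>i<d. \<nu> i < \<mu> i")
    case False
    have "\<nu> i = \<mu> i" if "i < d" for i
    proof (rule ccontr)
      assume "\<nu> i \<noteq> \<mu> i"
      moreover have le: "\<mu> k \<le> \<nu> k" if "k < d" for k using False that by force
      ultimately have "\<mu> i < \<nu> i" using that by (simp add: order.strict_iff_order)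
      then have "(\<Sum>i<d. \<mu> i) < (\<Sum>i<d. \<nu> i)"
        using le that by (intro sum_strict_mono_ex1) auto
      then show False using total by simp
    qed
    then show ?thesis using cong[OF less.prems(3)] by simp
  next
    case True
    \<comment> \<open>Take the last \<open>j\<close> with \<open>\<nu> j < \<mu> j\<close> and the first later \<open>k\<close> with \<open>\<nu> k > \<mu> k\<close>: in between
      \<open>\<nu>\<close> and \<open>\<mu>\<close> agree, so \<open>\<mu>\<close> still majorizes \<open>\<nu>\<close> after moving \<open>\<delta>\<close> from \<open>j\<close> to \<open>k\<close>.\<close>
    define j where "j = Max {i. i < d \<and> \<nu> i < \<mu> i}"
    have "j \<in> {i. i < d \<and> \<nu> i < \<mu> i}" unfolding j_def using True by (intro Max_in) auto
    then have j: "j < d" "\<nu> j < \<mu> j" by auto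
    have above_j: "\<mu> i \<le> \<nu> i" if "j < i" "i < d" for i
      using Max_ge[of "{i. i < d \<and> \<nu> i < \<mu> i}" i] that by (fastforce simp flip: j_def)
    \<comment> \<open>Otherwise both vectors agree after \<open>j\<close>, and equal totals together
      with majorization of the first \<open>j\<close> entries would force
      \<open>\<mu> j \<le> \<nu> j\<close>.\<close>
    have "\<exists>k. j < k \<and> k < d \<and> \<mu> k < \<nu> k"
    proof (rule ccontr)
      assume "\<not> ?thesis"
      then have eq: "\<nu> i = \<mu> i" if "j < i" "i < d" for i using above_j[OF that] that by force
      have split: "(\<Sum>i<d. f i) = (\<Sum>i<j. f i) + f j + (\<Sum>i\<in>{Suc j..<d}. f i)"
        for f :: "nat \<Rightarrow> real"
        using j sum.atLeastLessThan_concat[of 0 "Suc j" d f] by (simp add: atLeast0LessThan)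
      have "(\<Sum>i\<in>{Suc j..<d}. \<nu> i) = (\<Sum>i\<in>{Suc j..<d}. \<mu> i)"
        by (intro sum.cong) (auto intro: eq)
      then show False using split[of \<nu>] split[of \<mu>] total j maj[of j] by simp
    qed
    then have ex: "\<exists>k. j < k \<and> k < d \<and> \<mu> k < \<nu> k" .
    define k where "k = (LEAST k. j < k \<and> k < d \<and> \<mu> k < \<nu> k)"
    have k: "j < k" "k < d" "\<mu> k < \<nu> k" using LeastI_ex[OF ex] by (auto simp: k_def)
    have between: "\<nu> i = \<mu> i" if "j < i" "i < k" for i
      using not_less_Least[of i "\<lambda>k. j < k \<and> k < d \<and> \<mu> k < \<nu> k"] above_j[of i] that k(2)
      by (auto simp flip: k_def)
    \<comment> \<open>The smaller of the two gaps: neither entry overshoots its target and at least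
      one reaches it.\<close>
    define \<delta> where "\<delta> = min (\<mu> j - \<nu> j) (\<nu> k - \<mu> k)"
    \<comment> \<open>The chain \<open>\<mu> k < \<nu> k \<le> \<nu> j < \<mu> j\<close> makes the
      denominator positive and at least \<open>\<delta>\<close>, so this is an admissible
      weight.\<close>
    define t where "t = \<delta> / (\<mu> j - \<mu> k)"
    have gap: "\<delta> > 0" "\<delta> \<le> \<mu> j - \<nu> j" "\<delta> \<le> \<nu> k - \<mu> k" "\<nu> k \<le> \<nu> j"
      using j k dec[of j k] by (auto simp: \<delta>_def)
    then have t: "0 \<le> t" "t \<le> 1" "t * (\<mu> j - \<mu> k) = \<delta>" by (auto simp: t_def)
    define \<mu>' where "\<mu>' = t_transform j k t \<mu>"
    have \<mu>': "\<mu>' j = \<mu> j - \<delta>" "\<mu>' k = \<mu> k + \<delta>" "\<And>i. i \<noteq> j \<Longrightarrow> i \<noteq> k \<Longrightarrow> \<mu>' i = \<mu> i"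
      using t(3) k(1) by (auto simp: \<mu>'_def t_transform_def algebra_simps)
    have sum': "(\<Sum>i<n. \<mu>' i) = (\<Sum>i<n. \<mu> i) - (if j < n \<and> n \<le> k then \<delta> else 0)" for n
    proof -
      have "(\<Sum>i<n. \<mu>' i) = (\<Sum>i<n. \<mu> i - (if i = j then \<delta> else 0) + (if i = k then \<delta> else 0))"
        using \<mu>' by (intro sum.cong) auto
      then show ?thesis using k(1) by (auto simp: sum.distrib sum_subtractf)
    qed
    have "{i. i < d \<and> \<nu> i \<noteq> \<mu>' i} \<subset> {i. i < d \<and> \<nu> i \<noteq> \<mu> i}"
    proof -
      have sub: "\<nu> i \<noteq> \<mu> i" if "\<nu> i \<noteq> \<mu>' i" for i
        using that \<mu>'(3)[of i] j k by (cases "i = j \<or> i = k") auto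
      have "\<nu> j = \<mu>' j \<or> \<nu> k = \<mu>' k" using \<mu>' by (auto simp: \<delta>_def min_def)
      then show ?thesis using sub j k by auto
    qed
    then have "card {i. i < d \<and> \<nu> i \<noteq> \<mu>' i} < card {i. i < d \<and> \<nu> i \<noteq> \<mu> i}"
      by (intro psubset_card_mono) auto
    then show ?thesis
    proof (rule less.hyps)
      show "P \<mu>'" unfolding \<mu>'_def using less.prems(3) j k t by (intro step) auto
      show "(\<Sum>i<d. \<nu> i) = (\<Sum>i<d. \<mu>' i)" using total k by (simp add: sum')
      show "(\<Sum>i<n. \<nu> i) \<le> (\<Sum>i<n. \<mu>' i)" if n: "n \<le> d" for n
      proof (cases "j < n \<and> n \<le> k")
        case True
        \<comment> \<open>Prefixes containing \<open>j\<close> but not \<open>k\<close> are the only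
          ones that lose \<open>\<delta>\<close>; their slack is at least
          \<open>\<mu> j - \<nu> j\<close>, which covers the loss.\<close>
        have split: "(\<Sum>i<n. f i) = (\<Sum>i<j. f i) + f j + (\<Sum>i\<in>{Suc j..<n}. f i)"
          for f :: "nat \<Rightarrow> real"
          using True sum.atLeastLessThan_concat[of 0 "Suc j" n f] by (simp add: atLeast0LessThan)
        have "(\<Sum>i\<in>{Suc j..<n}. \<nu> i) = (\<Sum>i\<in>{Suc j..<n}. \<mu> i)"
          using True by (intro sum.cong) (auto intro: between)
        then show ?thesis
          using split[of \<nu>] split[of \<mu>] maj[of j] j gap(2) True by (simp add: sum')
      qed (use maj[OF n] in \<open>auto simp: sum'\<close>)
    qed
  qed
qed

section \<open>Controlled swaps acting on diagonal states\<close>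

definition perm_mat :: "nat \<Rightarrow> (nat \<Rightarrow> nat) \<Rightarrow> complex mat" where
  "perm_mat N p = mat N N (\<lambda>(a, b). if a = p b then 1 else 0)"

context
  fixes N :: nat and p :: "nat \<Rightarrow> nat"
  assumes p_less: "\<And>a. a < N \<Longrightarrow> p a < N" and p_invol: "\<And>a. a < N \<Longrightarrow> p (p a) = a"
begin

text \<open>A controlled swap is an involution, and for involutions the adjoint brings in no inverse
  permutation.\<close>

lemma mat_adjoint_perm_mat: "mat_adjoint (perm_mat N p) = perm_mat N p"
  by (rule eq_matI) (auto simp: perm_mat_def p_invol)

lemma perm_mat_conj_mat_diag:
  "perm_mat N p * mat_diag N y * mat_adjoint (perm_mat N p) = mat_diag N (\<lambda>a. y (p a))"
proof (rule eq_matI)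
  fix a b assume "a < dim_row (mat_diag N (\<lambda>a. y (p a)))" "b < dim_col (mat_diag N (\<lambda>a. y (p a)))"
  then have ab: "a < N" "b < N" by (auto simp: mat_diag_def)
  have c: "perm_mat N p \<in> carrier_mat N N" by (simp add: perm_mat_def)
  have "(perm_mat N p * mat_diag N y * mat_adjoint (perm_mat N p)) $$ (a, b)
      = (\<Sum>c<N. if c = p b then if a = p c then y c else 0 else 0)"
    unfolding mat_adjoint_perm_mat index_mult_mat_sum[OF mult_carrier_mat[OF c mat_diag_dim] c ab]
    unfolding mat_diag_mult_right[OF c]
    by (rule sum.cong[OF refl]) (use ab in \<open>simp add: perm_mat_def\<close>)
  also have "\<dots> = (if a = b then y (p b) else 0)" using p_less p_invol ab by simp
  finally show "(perm_mat N p * mat_diag N y * mat_adjoint (perm_mat N p)) $$ (a, b)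
      = mat_diag N (\<lambda>a. y (p a)) $$ (a, b)"
    using ab by (simp add: mat_diag_def)
qed (auto simp: perm_mat_def mat_diag_def)

lemma unitary_perm_mat: "unitary_mat N (perm_mat N p)"
proof (rule unitary_matI)
  show c: "perm_mat N p \<in> carrier_mat N N" by (simp add: perm_mat_def)
  have "perm_mat N p * 1\<^sub>m N * mat_adjoint (perm_mat N p) = 1\<^sub>m N"
    using perm_mat_conj_mat_diag[of "\<lambda>_. 1"] by simp
  then show "mat_adjoint (perm_mat N p) * perm_mat N p = 1\<^sub>m N"
    using c by (simp add: mat_adjoint_perm_mat)
qed

end

lemma tensor_mat_diag_max_mixed:
  "tensor_mat (mat_diag d x) (max_mixed K) = mat_diag (d * K) (\<lambda>q. x (q div K) / of_nat K)"
proof (cases "K = 0")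
  case False
  show ?thesis
  proof (rule eq_matI)
    fix p q assume "p < dim_row (mat_diag (d * K) (\<lambda>q. x (q div K) / of_nat K))"
      "q < dim_col (mat_diag (d * K) (\<lambda>q. x (q div K) / of_nat K))"
    then have pq: "p < d * K" "q < d * K" by (auto simp: mat_diag_def)
    then have "p div K < d" "q div K < d" "p mod K < K" "q mod K < K"
      using False by (auto simp: less_mult_imp_div_less)
    moreover have "p = q \<longleftrightarrow> p div K = q div K \<and> p mod K = q mod K"
      by (metis div_mult_mod_eq)
    ultimately show "tensor_mat (mat_diag d x) (max_mixed K) $$ (p, q)
        = mat_diag (d * K) (\<lambda>q. x (q div K) / of_nat K) $$ (p, q)"
      using pq by (auto simp: tensor_mat_def max_mixed_def mat_diag_def)
  qed (auto simp: tensor_mat_def max_mixed_def mat_diag_def)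
qed (auto simp: tensor_mat_def max_mixed_def mat_diag_def intro!: eq_matI)

lemma partial_trace_mat_diag:
  "partial_trace a b (mat_diag (a * b) z) = mat_diag a (\<lambda>i. \<Sum>k<b. z (i * b + k))"
proof (rule eq_matI)
  fix i j assume "i < dim_row (mat_diag a (\<lambda>i. \<Sum>k<b. z (i * b + k)))"
    "j < dim_col (mat_diag a (\<lambda>i. \<Sum>k<b. z (i * b + k)))"
  then have ij: "i < a" "j < a" by (auto simp: mat_diag_def)
  have "i * b + k = j * b + k \<longleftrightarrow> i = j" if "k < b" for k using that by auto
  then show "partial_trace a b (mat_diag (a * b) z) $$ (i, j)
      = mat_diag a (\<lambda>i. \<Sum>k<b. z (i * b + k)) $$ (i, j)"
    using ij mult_add_less[of i a _ b] mult_add_less[of j a _ b]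
    by (auto simp: partial_trace_def mat_diag_def)
qed (auto simp: partial_trace_def mat_diag_def)

text \<open>A swap of the levels \<open>i\<close> and \<open>j\<close>, controlled by an ancilla in the state \<open>\<tau>\<^sub>K\<close> and performed
  for \<open>m\<close> of its \<open>K\<close> levels, acts on diagonal states as a T-transform with weight \<open>m / K\<close>.\<close>

lemma noisy_op_t_transform:
  assumes ij: "i < d" "j < d" "i \<noteq> j" and m: "m \<le> K" "K > 0"
  obtains \<Lambda> where "noisy_op d d \<Lambda>"
    and "\<And>x. \<Lambda> (mat_diag d (\<lambda>l. complex_of_real (x l)))
      = mat_diag d (\<lambda>l. complex_of_real (t_transform i j (real m / real K) x l))"
proof -
  define s where "s l = (if l = i then j else if l = j then i else l)" for l
  \<comment> \<open>In the index \<open>q\<close> of the joint system, \<open>q div K\<close> is the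
    level of the system and \<open>q mod K\<close> that of the ancilla, which controls the swap and
    is left unchanged.\<close>
  define p where "p q = (if q mod K < m then s (q div K) * K + q mod K else q)" for q
  have s: "s l < d" if "l < d" for l using ij that by (auto simp: s_def)
  have ss: "s (s l) = l" for l by (auto simp: s_def)
  have p_eq: "p (l * K + k) = (if k < m then s l else l) * K + k" if "k < K" for l k
    using that by (simp add: p_def)
  have dm: "q = (q div K) * K + q mod K" "q mod K < K" for q using m by simp_all
  have p_less: "p q < d * K" if "q < d * K" for q
  proof -
    have "q div K < d" using that by (rule less_mult_imp_div_less)
    then show ?thesis using mult_add_less[OF s dm(2)] that by (simp add: p_def)
  qed
  have p_invol: "p (p q) = q" for q
  proof (cases "q mod K < m")
    case True
    then have "p q = s (q div K) * K + q mod K" by (simp add: p_def)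
    then have "p (p q) = q div K * K + q mod K" using p_eq[OF dm(2)[of q]] True ss by simp
    then show ?thesis by simp
  qed (simp add: p_def)
  define V where "V = perm_mat (d * K) p"
  define \<Lambda> where "\<Lambda> = (\<lambda>A. partial_trace d K (V * A * mat_adjoint V)) \<circ>
    (\<lambda>A. tensor_mat A (max_mixed K))"
  have V: "unitary_mat (d * K) V" unfolding V_def by (rule unitary_perm_mat[OF p_less p_invol])
  have "noisy_op d d \<Lambda>"
    unfolding \<Lambda>_def using ij m V
    by (intro noisy_op.compose[OF noisy_op.ancilla noisy_op.discard]) auto
  moreover have "\<Lambda> (mat_diag d (\<lambda>l. complex_of_real (x l)))
      = mat_diag d (\<lambda>l. complex_of_real (t_transform i j (real m / real K) x l))" for x
  proof -
    have "\<Lambda> (mat_diag d (\<lambda>l. complex_of_real (x l)))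
      = mat_diag d (\<lambda>l. \<Sum>k<K. complex_of_real (x (p (l * K + k) div K)) / of_nat K)"
      unfolding \<Lambda>_def o_def tensor_mat_diag_max_mixed V_def
      by (subst perm_mat_conj_mat_diag[OF p_less p_invol]) (auto simp: partial_trace_mat_diag)
    also have "\<dots> = mat_diag d (\<lambda>l. complex_of_real (t_transform i j (real m / real K) x l))"
    proof (rule arg_cong[of _ _ "mat_diag d"], rule ext)
      fix l
      have "(\<Sum>k<K. complex_of_real (x (p (l * K + k) div K)) / of_nat K)
        = complex_of_real (\<Sum>k<K. x (p (l * K + k) div K) / real K)" by simp
      also have "(\<Sum>k<K. x (p (l * K + k) div K) / real K)
        = (\<Sum>k<K. (if k < m then x (s l) else x l) / real K)"
        by (intro sum.cong refl) (simp add: p_eq)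
      also have "\<dots> = (\<Sum>k<K. if k < m then x (s l) else x l) / real K"
        by (simp add: sum_divide_distrib)
      also have "(\<Sum>k<K. if k < m then x (s l) else x l) = real m * x (s l) + real (K - m) * x l"
      proof -
        have "{..<K} \<inter> {k. k < m} = {..<m}" "{..<K} \<inter> - {k. k < m} = {m..<K}" using m by auto
        then show ?thesis by (simp add: sum.If_cases)
      qed
      also have "\<dots> / real K = t_transform i j (real m / real K) x l"
        using m ij by (simp add: t_transform_def s_def of_nat_diff field_simps)
      finally show "(\<Sum>k<K. complex_of_real (x (p (l * K + k) div K)) / of_nat K)
        = complex_of_real (t_transform i j (real m / real K) x l)" .
    qed
    finally show ?thesis .
  qed
  ultimately show thesis by (rule that)
qed

text \<open>Two errors add up: the one already present in \<open>y\<close> passes through a convex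
  combination and does not grow, and replacing the weight \<open>t\<close> by \<open>q\<close>
  shifts an entry by at most \<open>\<bar>q - t\<bar> * \<bar>x i - x j\<bar>\<close>.\<close>

lemma t_transform_approx:
  assumes q: "0 \<le> q" "q \<le> 1" "\<bar>q - t\<bar> * \<bar>x i - x j\<bar> \<le> e"
    and xy: "\<And>l. l < d \<Longrightarrow> \<bar>y l - x l\<bar> \<le> e" and ij: "i < d" "j < d" and l: "l < d"
  shows "\<bar>t_transform i j q y l - t_transform i j t x l\<bar> \<le> 2 * e"
proof -
  have mix: "\<bar>(1 - q) * a + q * b\<bar> \<le> e" if "\<bar>a\<bar> \<le> e" "\<bar>b\<bar> \<le> e" for a b
  proof -
    have "\<bar>(1 - q) * a + q * b\<bar> \<le> (1 - q) * \<bar>a\<bar> + q * \<bar>b\<bar>"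
      using q by (intro order_trans[OF abs_triangle_ineq]) (simp add: abs_mult)
    also have "\<dots> \<le> (1 - q) * e + q * e" using q that by (intro add_mono mult_left_mono) auto
    finally show ?thesis by (simp add: algebra_simps)
  qed
  have shift: "\<bar>(q - t) * (x i - x j)\<bar> \<le> e" using q by (simp add: abs_mult)
  consider "l = i" | "l = j" "l \<noteq> i" | "l \<noteq> i" "l \<noteq> j" by blast
  then show ?thesis
  proof cases
    case 1
    have "t_transform i j q y l - t_transform i j t x l
      = ((1 - q) * (y i - x i) + q * (y j - x j)) - (q - t) * (x i - x j)"
      using 1 by (simp add: t_transform_def algebra_simps)
    then show ?thesis using mix[OF xy[OF ij(1)] xy[OF ij(2)]] shift by linarith
  next
    case 2
    have "t_transform i j q y l - t_transform i j t x l
      = ((1 - q) * (y j - x j) + q * (y i - x i)) + (q - t) * (x i - x j)"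
      using 2 by (simp add: t_transform_def algebra_simps)
    then show ?thesis using mix[OF xy[OF ij(2)] xy[OF ij(1)]] shift by linarith
  next
    case 3
    then show ?thesis using xy[OF l] by (simp add: t_transform_def)
  qed
qed

text \<open>Rounding \<open>t\<close> down to a multiple of \<open>1 / K\<close> costs at most
  \<open>1 / K\<close> and keeps \<open>m \<le> K\<close>. The factor \<open>c\<close> will be the
  distance of the two mixed entries; as a factor instead of a divisor it may vanish.\<close>

lemma rational_weight:
  fixes t c e :: real
  assumes t: "0 \<le> t" "t \<le> 1" and e: "e > 0" and c: "c \<ge> 0"
  obtains m K :: nat where "m \<le> K" "K > 0" "\<bar>real m / real K - t\<bar> * c \<le> e"
proof -
  obtain K0 :: nat where K0: "c / e < real K0" using reals_Archimedean2 by blast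
  define K where "K = Suc K0"
  define m where "m = nat \<lfloor>t * real K\<rfloor>"
  have "t * real K \<ge> 0" using t by simp
  then have m: "real m \<le> t * real K" "t * real K < real m + 1" by (auto simp: m_def)
  have K: "K > 0" by (simp add: K_def)
  have "t * real K \<le> real K" using t by (simp add: mult_left_le_one_le)
  then have "m \<le> K" using m by linarith
  moreover have "\<bar>real m / real K - t\<bar> \<le> 1 / real K"
  proof -
    have "real m / real K - t = (real m - t * real K) / real K" using K by (simp add: field_simps)
    moreover have "\<bar>real m - t * real K\<bar> \<le> 1" using m by linarith
    ultimately show ?thesis using K by (simp add: abs_divide divide_right_mono)
  qed
  then have "\<bar>real m / real K - t\<bar> * c \<le> 1 / real K * c" using c by (rule mult_right_mono)
  moreover have "1 / real K * c \<le> e"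
    using K0 e K by (simp add: K_def field_simps)
  ultimately show thesis using that[of m K] K by linarith
qed

section \<open>From eigenvalue vectors back to states\<close>

lemma more_mixed_imp_no_transition:
  assumes \<rho>: "pos_semidef d \<rho>" and \<sigma>: "pos_semidef d \<sigma>" and tr: "mtrace \<rho> = mtrace \<sigma>"
    and mixed: "more_mixed d \<sigma> \<rho>"
  shows "no_transition d \<rho> \<sigma>"
proof -
  define \<mu> \<nu> where "\<mu> i = eigvals_decr \<rho> ! i" and "\<nu> i = eigvals_decr \<sigma> ! i" for i
  obtain U where U: "unitary_mat d U"
    and \<rho>_eq: "\<rho> = U * mat_diag d (\<lambda>i. complex_of_real (\<mu> i)) * mat_adjoint U"
    using pos_semidef_spectral(3)[OF \<rho>] unfolding \<mu>_def by blast
  obtain V where V: "unitary_mat d V"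
    and \<sigma>_eq: "\<sigma> = V * mat_diag d (\<lambda>i. complex_of_real (\<nu> i)) * mat_adjoint V"
    using pos_semidef_spectral(3)[OF \<sigma>] unfolding \<nu>_def by blast
  \<comment> \<open>\<open>more_mixed\<close> supplies inequalities only; the equality of the full
    sums comes from the traces.\<close>
  have "mtrace \<rho> = complex_of_real (\<Sum>i<d. \<mu> i)"
    unfolding \<rho>_eq by (subst mtrace_unitary_conj[OF U]) (simp_all add: mtrace_mat_diag)
  moreover have "mtrace \<sigma> = complex_of_real (\<Sum>i<d. \<nu> i)"
    unfolding \<sigma>_eq by (subst mtrace_unitary_conj[OF V]) (simp_all add: mtrace_mat_diag)
  ultimately have total: "(\<Sum>i<d. \<nu> i) = (\<Sum>i<d. \<mu> i)" using tr by (simp only: of_real_eq_iff)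
  \<comment> \<open>The tolerance is quantified inside \<open>P\<close>, so each T-transform can ask
    its predecessor for half of it. The output is exactly diagonal and only its entries are
    approximate, so the next controlled swap applies to it.\<close>
  define P where "P x \<longleftrightarrow> (\<forall>e>0. \<exists>\<Lambda> y. noisy_op d d \<Lambda> \<and>
    \<Lambda> (mat_diag d (\<lambda>l. complex_of_real (\<mu> l))) = mat_diag d (\<lambda>l. complex_of_real (y l)) \<and>
    (\<forall>l<d. \<bar>y l - x l\<bar> \<le> e))" for x
  have "P \<nu>"
  proof (rule majorization_t_transform_induct[of d \<nu> \<mu> P])
    show "\<nu> j \<le> \<nu> i" if "i \<le> j" "j < d" for i j
      using pos_semidef_spectral(2)[OF \<sigma> that] by (simp add: \<nu>_def)
    show "(\<Sum>i<k. \<nu> i) \<le> (\<Sum>i<k. \<mu> i)" if "k \<le> d" for k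
      using mixed that by (simp add: more_mixed_def \<nu>_def \<mu>_def)
    show "P \<mu>"
      unfolding P_def
    proof (intro allI impI)
      fix e :: real assume "e > 0"
      \<comment> \<open>The identity map enters as conjugation by the identity matrix, since every
        noisy operation is built from the listed generators.\<close>
      have 1: "unitary_mat d (1\<^sub>m d)"
        using unitary_perm_mat[of d id] by (simp add: perm_mat_def one_mat_def)
      then have "1\<^sub>m d * mat_diag d (\<lambda>l. complex_of_real (\<mu> l)) * mat_adjoint (1\<^sub>m d)
          = mat_diag d (\<lambda>l. complex_of_real (\<mu> l))"
        using unitary_matD[OF 1]
        by (simp add: left_mult_one_mat[OF mat_diag_dim] right_mult_one_mat[OF mat_diag_dim])
      then show "\<exists>\<Lambda> y. noisy_op d d \<Lambda> \<and>
        \<Lambda> (mat_diag d (\<lambda>l. complex_of_real (\<mu> l))) = mat_diag d (\<lambda>l. complex_of_real (y l)) \<and>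
        (\<forall>l<d. \<bar>y l - \<mu> l\<bar> \<le> e)"
        using noisy_op.unitary[OF 1] \<open>e > 0\<close>
        by (intro exI[of _ "\<lambda>\<rho>. 1\<^sub>m d * \<rho> * mat_adjoint (1\<^sub>m d)"] exI[of _ \<mu>]) auto
    qed
    show "P y" if "P x" "\<And>i. i < d \<Longrightarrow> x i = y i" for x y
      using that by (simp add: P_def)
    show "P (t_transform i j t x)"
      if x: "P x" and ij: "i < d" "j < d" "i \<noteq> j" and t: "0 \<le> t" "t \<le> 1" for x i j t
      unfolding P_def
    proof (intro allI impI)
      fix e :: real assume "e > 0"
      then have e: "e / 2 > 0" by simp
      obtain \<Lambda> y where \<Lambda>: "noisy_op d d \<Lambda>"
        "\<Lambda> (mat_diag d (\<lambda>l. complex_of_real (\<mu> l))) = mat_diag d (\<lambda>l. complex_of_real (y l))"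
        and y: "\<And>l. l < d \<Longrightarrow> \<bar>y l - x l\<bar> \<le> e / 2"
        using x e unfolding P_def by blast
      obtain m K :: nat where mK: "m \<le> K" "K > 0" "\<bar>real m / real K - t\<bar> * \<bar>x i - x j\<bar> \<le> e / 2"
        using rational_weight[OF t e abs_ge_zero] .
      obtain \<Gamma> where \<Gamma>: "noisy_op d d \<Gamma>"
        "\<And>x. \<Gamma> (mat_diag d (\<lambda>l. complex_of_real (x l)))
          = mat_diag d (\<lambda>l. complex_of_real (t_transform i j (real m / real K) x l))"
        using noisy_op_t_transform[OF ij mK(1,2)] by blast
      have "\<bar>t_transform i j (real m / real K) y l - t_transform i j t x l\<bar> \<le> e" if "l < d" for l
        using t_transform_approx[of "real m / real K" t x i j "e / 2" d y l] mK y ij that by simp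
      then show "\<exists>\<Lambda> y. noisy_op d d \<Lambda> \<and>
        \<Lambda> (mat_diag d (\<lambda>l. complex_of_real (\<mu> l))) = mat_diag d (\<lambda>l. complex_of_real (y l)) \<and>
        (\<forall>l<d. \<bar>y l - t_transform i j t x l\<bar> \<le> e)"
        using noisy_op.compose[OF \<Lambda>(1) \<Gamma>(1)] \<Lambda>(2) \<Gamma>(2)
        by (intro exI[of _ "\<Gamma> \<circ> \<Lambda>"] exI[of _ "t_transform i j (real m / real K) y"]) auto
    qed
  qed (fact total)
  show ?thesis
    unfolding no_transition_def
  proof (intro allI impI)
    fix e :: real assume e: "e > 0"
    \<comment> \<open>The \<open>d\<close> entrywise errors add up to at most \<open>e\<close>; the
      successor avoids a division by zero, as \<open>d = 0\<close> is not excluded here.\<close>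
    then have "e / real (Suc d) > 0" by simp
    then obtain \<Lambda> y where \<Lambda>: "noisy_op d d \<Lambda>"
      "\<Lambda> (mat_diag d (\<lambda>l. complex_of_real (\<mu> l))) = mat_diag d (\<lambda>l. complex_of_real (y l))"
      and y: "\<And>l. l < d \<Longrightarrow> \<bar>y l - \<nu> l\<bar> \<le> e / real (Suc d)"
      using \<open>P \<nu>\<close> unfolding P_def by blast
    \<comment> \<open>\<open>\<rho>\<close> is rotated to its diagonal form, transformed there and
      rotated into the eigenbasis \<open>V\<close> of \<open>\<sigma>\<close>. The double adjoint
      matches the shape of the rule \<open>noisy_op.unitary\<close>.\<close>
    define \<Gamma> where "\<Gamma> = (\<lambda>A. V * A * mat_adjoint V) \<circ> (\<Lambda> \<circ>
      (\<lambda>A. mat_adjoint U * A * mat_adjoint (mat_adjoint U)))"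
    have \<Gamma>: "noisy_op d d \<Gamma>"
      unfolding \<Gamma>_def
      by (rule noisy_op.compose[OF noisy_op.compose[OF
            noisy_op.unitary[OF unitary_mat_adjoint[OF U]] \<Lambda>(1)] noisy_op.unitary[OF V]])
    have "mat_adjoint U * \<rho> * U = mat_diag d (\<lambda>i. complex_of_real (\<mu> i))"
      unfolding \<rho>_eq by (rule unitary_conj_cancel(2)[OF U]) simp
    then have \<Gamma>\<rho>: "\<Gamma> \<rho> = V * mat_diag d (\<lambda>i. complex_of_real (y i)) * mat_adjoint V"
      by (simp add: \<Gamma>_def \<Lambda>(2))
    have diag: "mat_diag d (\<lambda>i. complex_of_real (y i)) - mat_diag d (\<lambda>i. complex_of_real (\<nu> i))
        = mat_diag d (\<lambda>i. complex_of_real (y i - \<nu> i))"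
      by (rule eq_matI) (auto simp: mat_diag_def)
    note v = unitary_matD[OF V]
    have "\<Gamma> \<rho> - \<sigma> = V * mat_diag d (\<lambda>i. complex_of_real (y i - \<nu> i)) * mat_adjoint V"
      unfolding \<Gamma>\<rho> \<sigma>_eq diag[symmetric]
      unfolding mult_minus_distrib_mat[OF v(1) mat_diag_dim mat_diag_dim]
      by (rule minus_mult_distrib_mat[symmetric, OF mult_carrier_mat[OF v(1) mat_diag_dim]
            mult_carrier_mat[OF v(1) mat_diag_dim] v(2)])
    then have "trace_norm (\<Gamma> \<rho> - \<sigma>) = (\<Sum>i<d. \<bar>y i - \<nu> i\<bar>)"
      by (simp only: trace_norm_diagonal[OF V])
    also have "\<dots> \<le> (\<Sum>i<d. e / real (Suc d))" using y by (intro sum_mono) auto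
    also have "\<dots> = real d / real (Suc d) * e" by simp
    also have "\<dots> \<le> 1 * e" using e by (intro mult_right_mono) auto
    finally show "\<exists>\<Lambda>. noisy_op d d \<Lambda> \<and> trace_norm (\<Lambda> \<rho> - \<sigma>) \<le> e" using \<Gamma> by auto
  qed
qed

theorem proposition1:
  fixes d :: nat and \<rho> \<sigma> :: "complex mat"
  assumes "state d \<rho>" and "state d \<sigma>"
  shows "no_transition d \<rho> \<sigma> \<longleftrightarrow> more_mixed d \<sigma> \<rho>"
  using assms no_transition_imp_more_mixed more_mixed_imp_no_transition
  by (auto simp: state_def)

end
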